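(* Let $H$ be a Hopf algebra with bijective antipode over a field $k$, let $C$ be a right $H$-module coalgebra, and let $\tau,\lambda$ be twistings of $C$ which are equivalent, $\tau\sim\lambda$. If $\tau$ is invertible in the algebra $(\mathrm{Hom}(C,H\otimes C),\ast)$, then $\lambda$ is also invertible in this algebra.
   Context: All maps are $k$-linear; $\Delta(c)=c_1\otimes c_2$ (Sweedler notation, summation understood); $S$ is the antipode of $H$. A right $H$-module coalgebra is a coalgebra $C$ that is a right $H$-module with $\Delta(c\cdot h)=c_1\cdot h_1\otimes c_2\cdot h_2$ and $\varepsilon_C(c\cdot h)=\varepsilon_C(c)\varepsilon_H(h)$. Twistings. $\mathrm{Hom}(C,H\otimes C)$ is an algebra with product $\tau\ast\lambda=(m_H\otimes id_C)\circ(id_H\otimes\lambda)\circ\tau$ and unit $\sigma(c)=1\otimes c$. Write $\tau(c)=c_{-1}\otimes c_0$. Suppose $\tau$ is normalized: $c_{-1}\varepsilon_C(c_0)=\varepsilon_C(c)1_H$ and $\varepsilon_H(c_{-1})c_0=c$. Let $C^\tau$ be $C$ as a right $H$-module, with comultiplication $\Delta_\tau(c)=c_1\cdot c_{2.-1}\otimes c_{2.0}$, where $\tau(c_2)=c_{2.-1}\otimes c_{2.0}$ (counit $\varepsilon_C$). $\mathcal M_H^C$ is the category of right $H$-modules and right $C$-comodules $M$ with $\rho(m\cdot h)=m_0\cdot h_1\otimes m_1\cdot h_2$; for such $M$, $M^\tau$ is $M$ as an $H$-module with $\rho^\tau(m)=m_0\cdot m_{1.-1}\otimes m_{1.0}$.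 A normalized $\tau$ is called a twisting of $C$ if $C^\tau$ is a right $H$-module coalgebra and $M^\tau\in\mathcal M_H^{C^\tau}$ for all $M\in\mathcal M_H^C$. It is known that a normalized $\tau$ is a twisting if and only if, for all $c\in C,h\in H$: $c_{-1}h_1\otimes c_0\cdot h_2=h_1(c\cdot h_2)_{-1}\otimes(c\cdot h_2)_0$ and $c_{-1}\otimes c_{0.1}\cdot c_{0.2.-1}\otimes c_{0.2.0}=c_{1.-1}c_{2.-1.1}\otimes c_{1.0}\cdot c_{2.-1.2}\otimes c_{2.0}$ (a final numerical index $.1$ or $.2$ denotes a component of the original comultiplication of $C$ or of $H$). Equivalence. Let $\tau,\lambda$ be twistings, $\tau(c)=c_{-1}\otimes c_0$, $\lambda(c)=c_{(-1)}\otimes c_{(0)}$. $\tau\sim\lambda$ means: there is a convolution invertible map $v\in\mathrm{Hom}(C,H)$ such that for all $c\in C,h\in H$: $\varepsilon_H\circ v=\varepsilon_C$; $v(c\cdot h)=S(h_1)v(c)h_2$; and $c_{1.(-1)}v(c_2)_1\otimes c_{1.(0)}\cdot v(c_2)_2=v(c_1)c_{2.-1}\otimes c_{2.0.1}\cdot v(c_{2.0.2})$, where $\lambda(c_1)=c_{1.(-1)}\otimes c_{1.(0)}$, $\tau(c_2)=c_{2.-1}\otimes c_{2.0}$, and $c_{2.0.1}\otimes c_{2.0.2}=\Delta(c_{2.0})$. *)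

theory Defs
  imports Complex_Main "HOL-Library.Function_Algebras"
begin

section \<open>Tensor products and Sweedler notation\<close>

definition pscale :: "'k::field \<Rightarrow> ('x \<Rightarrow> 'k) \<Rightarrow> 'x \<Rightarrow> 'k"
  where "pscale a f = (\<lambda>x. a * f x)"

definition bilinear_map ::
  "('k::field \<Rightarrow> 'a::ab_group_add \<Rightarrow> 'a) \<Rightarrow> ('k \<Rightarrow> 'b::ab_group_add \<Rightarrow> 'b) \<Rightarrow>
   ('k \<Rightarrow> 'v::ab_group_add \<Rightarrow> 'v) \<Rightarrow> ('a \<Rightarrow> 'b \<Rightarrow> 'v) \<Rightarrow> bool"
  where "bilinear_map sA sB sV f \<longleftrightarrow>
    (\<forall>a. Vector_Spaces.linear sB sV (f a)) \<and> (\<forall>b. Vector_Spaces.linear sA sV (\<lambda>a. f a b))"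

text \<open>
  For vector spaces \<open>A\<close>, \<open>B\<close> over a field \<open>k\<close>, the canonical map from \<open>A \<otimes> B\<close> to the dual of
  the space of bilinear forms \<open>A \<times> B \<rightarrow> k\<close> is injective. The tensor product is
  realised as its image: a pure tensor is the evaluation functional, and \<open>A \<otimes> B\<close> is the linear
  span of the pure tensors inside the vector space (under \<^const>\<open>pscale\<close>) of all functionals.
  Lemma \<open>sweedler_eq\<close> below is the universal property.

  If \<open>V\<close> is a subspace of \<open>A\<close> then \<open>V \<otimes> B\<close> is a subspace of \<open>A \<otimes> B\<close>, because \<open>k\<close> is a field.
  So the ambient type of a tensor product can itself be used as a tensor factor: identities
  in \<open>A \<otimes> (B \<otimes> D)\<close> are stated in \<open>A \<otimes> T\<close> with \<open>T\<close> the space of all functionals containing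
  \<open>B \<otimes> D\<close>.
\<close>

type_synonym ('k, 'a, 'b) tensor = "('a \<Rightarrow> 'b \<Rightarrow> 'k) \<Rightarrow> 'k"

definition tens ::
  "('k::field \<Rightarrow> 'a::ab_group_add \<Rightarrow> 'a) \<Rightarrow> ('k \<Rightarrow> 'b::ab_group_add \<Rightarrow> 'b) \<Rightarrow> 'a \<Rightarrow> 'b \<Rightarrow>
   ('k, 'a, 'b) tensor"
  where "tens sA sB a b = (\<lambda>\<beta>. if bilinear_map sA sB (*) \<beta> then \<beta> a b else 0)"

abbreviation tens_syntax  ("_ \<otimes>\<^bsub>_,_\<^esub> _" [76, 0, 0, 75] 75)
  where "a \<otimes>\<^bsub>sA,sB\<^esub> b \<equiv> tens sA sB a b"

definition tensor_space ::
  "('k::field \<Rightarrow> 'a::ab_group_add \<Rightarrow> 'a) \<Rightarrow> ('k \<Rightarrow> 'b::ab_group_add \<Rightarrow> 'b) \<Rightarrow> 'a set \<Rightarrow>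
   ('k, 'a, 'b) tensor set"
  where "tensor_space sA sB V = module.span pscale {a \<otimes>\<^bsub>sA,sB\<^esub> b | a b. a \<in> V}"

text \<open>
  \<open>sweedler sA sB V t (\<lambda>a b. f a b)\<close> is the sum of the \<open>f a\<^sub>i b\<^sub>i\<close> for some way of writing
  \<open>t \<in> V \<otimes> B\<close> as a finite sum of pure tensors \<open>a\<^sub>i \<otimes> b\<^sub>i\<close> with \<open>a\<^sub>i \<in> V\<close>. For bilinear \<open>f\<close> it does not
  depend on the choice.
\<close>

definition sweedler ::
  "('k::field \<Rightarrow> 'a::ab_group_add \<Rightarrow> 'a) \<Rightarrow> ('k \<Rightarrow> 'b::ab_group_add \<Rightarrow> 'b) \<Rightarrow> 'a set \<Rightarrow>
   ('k, 'a, 'b) tensor \<Rightarrow> ('a \<Rightarrow> 'b \<Rightarrow> 'v) \<Rightarrow> 'v::ab_group_add"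
  where "sweedler sA sB V t f =
    (let ps = (SOME ps. set ps \<subseteq> V \<times> UNIV \<and> t = (\<Sum>(a, b)\<leftarrow>ps. a \<otimes>\<^bsub>sA,sB\<^esub> b))
     in \<Sum>(a, b)\<leftarrow>ps. f a b)"

lemma vector_space_pscale: "vector_space pscale"
  by unfold_locales (auto simp: pscale_def fun_eq_iff algebra_simps)

lemma bilinear_map_vector_space:
  assumes "bilinear_map sA sB sV f"
  shows "vector_space sA" "vector_space sB" "vector_space sV"
  using assms by (auto simp: bilinear_map_def Vector_Spaces.linear_iff)

lemma vector_space_field: "vector_space ((*) :: 'k::field \<Rightarrow> 'k \<Rightarrow> 'k)"
  by unfold_locales (auto simp: algebra_simps)

lemma bilinear_map_tens:
  assumes "vector_space sA" "vector_space sB"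
  shows "bilinear_map sA sB pscale (tens sA sB)"
  unfolding bilinear_map_def Vector_Spaces.linear_iff
  using assms vector_space_pscale
  by (auto simp: tens_def pscale_def fun_eq_iff bilinear_map_def Vector_Spaces.linear_iff)

lemma tensor_space_iff:
  assumes A: "vector_space sA" and B: "vector_space sB" and V: "module.subspace sA V"
  shows "t \<in> tensor_space sA sB V \<longleftrightarrow>
    (\<exists>ps. set ps \<subseteq> V \<times> UNIV \<and> t = (\<Sum>(a, b)\<leftarrow>ps. a \<otimes>\<^bsub>sA,sB\<^esub> b))"
proof -
  interpret A: vector_space sA by fact
  interpret P: vector_space pscale by (rule vector_space_pscale)
  note bil = bilinear_map_tens[OF A B, unfolded bilinear_map_def Vector_Spaces.linear_iff]
  show ?thesis
  proof
    assume "t \<in> tensor_space sA sB V"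
    then show "\<exists>ps. set ps \<subseteq> V \<times> UNIV \<and> t = (\<Sum>(a, b)\<leftarrow>ps. a \<otimes>\<^bsub>sA,sB\<^esub> b)"
      unfolding tensor_space_def
    proof (induction rule: P.span_induct_alt)
      case base
      show ?case by (rule exI[of _ "[]"]) simp
    next
      case (step c x y)
      then obtain ps a b where ps: "set ps \<subseteq> V \<times> UNIV" "y = (\<Sum>(a, b)\<leftarrow>ps. a \<otimes>\<^bsub>sA,sB\<^esub> b)"
        and x: "x = a \<otimes>\<^bsub>sA,sB\<^esub> b" "a \<in> V" by blast
      have "pscale c x = sA c a \<otimes>\<^bsub>sA,sB\<^esub> b" using bil x by auto
      with ps x show ?case
        by (intro exI[of _ "(sA c a, b) # ps"]) (auto intro: A.subspace_scale[OF V])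
    qed
  next
    assume "\<exists>ps. set ps \<subseteq> V \<times> UNIV \<and> t = (\<Sum>(a, b)\<leftarrow>ps. a \<otimes>\<^bsub>sA,sB\<^esub> b)"
    then obtain ps where ps: "set ps \<subseteq> V \<times> UNIV" "t = (\<Sum>(a, b)\<leftarrow>ps. a \<otimes>\<^bsub>sA,sB\<^esub> b)" by blast
    have "set ps \<subseteq> V \<times> UNIV \<Longrightarrow> (\<Sum>(a, b)\<leftarrow>ps. a \<otimes>\<^bsub>sA,sB\<^esub> b) \<in> tensor_space sA sB V"
    proof (induction ps)
      case Nil
      show ?case unfolding tensor_space_def list.map sum_list.Nil by (rule P.span_zero)
    next
      case (Cons p ps)
      obtain a b where p: "p = (a, b)" "a \<in> V" using Cons.prems by auto
      have "a \<otimes>\<^bsub>sA,sB\<^esub> b \<in> tensor_space sA sB V"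
        unfolding tensor_space_def by (rule P.span_base) (use p in auto)
      moreover have "(\<Sum>(a, b)\<leftarrow>ps. a \<otimes>\<^bsub>sA,sB\<^esub> b) \<in> tensor_space sA sB V"
        using Cons by simp
      ultimately show ?case
        unfolding tensor_space_def list.map sum_list.Cons p(1) prod.case by (rule P.span_add)
    qed
    with ps show "t \<in> tensor_space sA sB V" by simp
  qed
qed

lemma linear_functional_separates:
  assumes "vector_space sV" "v \<noteq> 0"
  obtains \<phi> where "Vector_Spaces.linear sV (*) \<phi>" "\<phi> v \<noteq> 0"
proof -
  interpret V: vector_space sV by fact
  interpret K: vector_space "(*)" by (rule vector_space_field)
  interpret VK: vector_space_pair sV "(*)" ..
  have i: "V.independent {v}" using assms by (simp add: V.dependent_single)
  define \<phi> where "\<phi> = VK.construct {v} (\<lambda>_. 1)"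
  have "Vector_Spaces.linear sV (*) \<phi>" unfolding \<phi>_def by (rule VK.linear_construct[OF i])
  moreover have "\<phi> v = 1" unfolding \<phi>_def by (rule VK.construct_basis[OF i]) simp
  ultimately show ?thesis using that by simp
qed

lemma linear_projection_exists:
  assumes "vector_space sA" "module.subspace sA V"
  obtains p where "Vector_Spaces.linear sA sA p" "\<And>a. p a \<in> V" "\<And>a. a \<in> V \<Longrightarrow> p a = a"
proof -
  interpret A: vector_space sA by fact
  interpret AA: vector_space_pair sA sA ..
  obtain B where B: "B \<subseteq> V" "A.independent B" "V \<subseteq> A.span B"
    using A.maximal_independent_subset by blast
  have BV: "A.span B = V" using A.span_subspace[OF B(1,3) assms(2)] .
  define p where "p = AA.construct B id"
  have lin: "Vector_Spaces.linear sA sA p" unfolding p_def by (rule AA.linear_construct[OF B(2)])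
  have "p a \<in> A.span (id ` B)" for a
    unfolding p_def by (rule AA.construct_in_span[OF B(2)])
  then have "p a \<in> V" for a using BV by simp
  moreover have "p a = a" if "a \<in> V" for a
  proof -
    have "p b = id b" if "b \<in> B" for b
      unfolding p_def using AA.construct_basis[OF B(2) that] by simp
    then show ?thesis
      using AA.linear_eq_on[OF lin A.linear_id, of a B] that BV by auto
  qed
  ultimately show ?thesis using that lin by blast
qed

lemma sum_list_tens_eqD:
  assumes f: "bilinear_map sA sB sV f"
    and eq: "(\<Sum>(a, b)\<leftarrow>ps. a \<otimes>\<^bsub>sA,sB\<^esub> b) = (\<Sum>(a, b)\<leftarrow>qs. a \<otimes>\<^bsub>sA,sB\<^esub> b)"
  shows "(\<Sum>(a, b)\<leftarrow>ps. f a b) = (\<Sum>(a, b)\<leftarrow>qs. f a b)"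
proof (rule ccontr)
  assume "\<not> ?thesis"
  then have "(\<Sum>(a, b)\<leftarrow>ps. f a b) - (\<Sum>(a, b)\<leftarrow>qs. f a b) \<noteq> 0" by simp
  then obtain \<phi> where \<phi>: "Vector_Spaces.linear sV (*) \<phi>"
    and ne: "\<phi> ((\<Sum>(a, b)\<leftarrow>ps. f a b) - (\<Sum>(a, b)\<leftarrow>qs. f a b)) \<noteq> 0"
    using linear_functional_separates bilinear_map_vector_space(3)[OF f] by blast
  interpret \<phi>: Vector_Spaces.linear sV "(*)" \<phi> by (rule \<phi>)
  have bil: "bilinear_map sA sB (*) (\<lambda>a b. \<phi> (f a b))"
    using f \<phi> by (auto simp: bilinear_map_def Vector_Spaces.linear_iff)
  have 1: "\<phi> (\<Sum>(a, b)\<leftarrow>rs. f a b) = (\<Sum>(a, b)\<leftarrow>rs. a \<otimes>\<^bsub>sA,sB\<^esub> b) (\<lambda>a b. \<phi> (f a b))" for rs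
    using bil by (induction rs) (auto simp: \<phi>.add tens_def)
  show False using ne eq by (simp add: \<phi>.diff 1)
qed

lemma sweedler_eq:
  assumes A: "vector_space sA" and B: "vector_space sB" and W: "vector_space sW"
    and V: "module.subspace sA V"
    and ps: "set ps \<subseteq> V \<times> UNIV" "t = (\<Sum>(a, b)\<leftarrow>ps. a \<otimes>\<^bsub>sA,sB\<^esub> b)"
    and right: "\<And>a. a \<in> V \<Longrightarrow> Vector_Spaces.linear sB sW (f a)"
    and add: "\<And>a a' b. a \<in> V \<Longrightarrow> a' \<in> V \<Longrightarrow> f (a + a') b = f a b + f a' b"
    and scale: "\<And>r a b. a \<in> V \<Longrightarrow> f (sA r a) b = sW r (f a b)"
  shows "sweedler sA sB V t f = (\<Sum>(a, b)\<leftarrow>ps. f a b)"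
proof -
  obtain p where p: "Vector_Spaces.linear sA sA p" "\<And>a. p a \<in> V" "\<And>a. a \<in> V \<Longrightarrow> p a = a"
    using linear_projection_exists[OF A V] by metis
  interpret p: Vector_Spaces.linear sA sA p by (rule p)
  have bil: "bilinear_map sA sB sW (\<lambda>a b. f (p a) b)"
    unfolding bilinear_map_def
  proof (intro conjI allI)
    show "Vector_Spaces.linear sB sW (f (p a))" for a by (rule right[OF p(2)])
    show "Vector_Spaces.linear sA sW (\<lambda>a. f (p a) b)" for b
      by (simp add: Vector_Spaces.linear_iff A W p.add p.scale add scale p(2))
  qed
  have pf: "(\<Sum>(a, b)\<leftarrow>rs. f (p a) b) = (\<Sum>(a, b)\<leftarrow>rs. f a b)" if "set rs \<subseteq> V \<times> UNIV" for rs
    using that p(3) by (intro arg_cong[where f = sum_list] map_cong) auto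
  define qs where "qs = (SOME ps. set ps \<subseteq> V \<times> UNIV \<and> t = (\<Sum>(a, b)\<leftarrow>ps. a \<otimes>\<^bsub>sA,sB\<^esub> b))"
  have qs: "set qs \<subseteq> V \<times> UNIV" "t = (\<Sum>(a, b)\<leftarrow>qs. a \<otimes>\<^bsub>sA,sB\<^esub> b)"
    using someI[of "\<lambda>ps. set ps \<subseteq> V \<times> UNIV \<and> t = (\<Sum>(a, b)\<leftarrow>ps. a \<otimes>\<^bsub>sA,sB\<^esub> b)" ps] ps
    unfolding qs_def by auto
  have "sweedler sA sB V t f = (\<Sum>(a, b)\<leftarrow>qs. f a b)" by (simp add: sweedler_def qs_def)
  also have "\<dots> = (\<Sum>(a, b)\<leftarrow>ps. f a b)"
    using sum_list_tens_eqD[OF bil, of qs ps] pf[OF qs(1)] pf[OF ps(1)] qs(2) ps(2) by simp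
  finally show ?thesis .
qed


section \<open>Coalgebras, Hopf algebras and module coalgebras\<close>

text \<open>
  The underlying vector space of a coalgebra or Hopf algebra is a whole type with its addition and
  the scalar multiplication \<open>scl\<close>; the product and unit of a Hopf algebra are those of the type.
\<close>

record ('k, 'c) coalg =
  scl :: "'k \<Rightarrow> 'c \<Rightarrow> 'c"
  comult :: "'c \<Rightarrow> ('k, 'c, 'c) tensor"
  counit :: "'c \<Rightarrow> 'k"

record ('k, 'h) hopf = "('k, 'h) coalg" +
  antipode :: "'h \<Rightarrow> 'h"

record ('k, 'h, 'c) modcoalg = "('k, 'c) coalg" +
  act :: "'c \<Rightarrow> 'h \<Rightarrow> 'c"

text \<open>\<open>comult_sum C c (\<lambda>c1 c2. F c1 c2)\<close> is \<open>F(c\<^sub>1, c\<^sub>2)\<close> in Sweedler notation.\<close>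

abbreviation comult_sum ::
  "('k::field, 'c::ab_group_add, 'z) coalg_scheme \<Rightarrow> 'c \<Rightarrow> ('c \<Rightarrow> 'c \<Rightarrow> 'v::ab_group_add) \<Rightarrow> 'v"
  where "comult_sum C c \<equiv> sweedler (scl C) (scl C) UNIV (comult C c)"

locale coalgebra =
  fixes C :: "('k::field, 'c::ab_group_add, 'z) coalg_scheme"
  assumes vector_space: "vector_space (scl C)"
    and comult_in: "comult C c \<in> tensor_space (scl C) (scl C) UNIV"
    and comult_linear: "Vector_Spaces.linear (scl C) pscale (comult C)"
    and counit_linear: "Vector_Spaces.linear (scl C) (*) (counit C)"
    and coassoc:
      "comult_sum C c (\<lambda>c1 c2. comult_sum C c1 (\<lambda>c11 c12.
         c11 \<otimes>\<^bsub>scl C,pscale\<^esub> (c12 \<otimes>\<^bsub>scl C,scl C\<^esub> c2))) =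
       comult_sum C c (\<lambda>c1 c2. comult_sum C c2 (\<lambda>c21 c22.
         c1 \<otimes>\<^bsub>scl C,pscale\<^esub> (c21 \<otimes>\<^bsub>scl C,scl C\<^esub> c22)))"
    and counit_left: "comult_sum C c (\<lambda>c1 c2. scl C (counit C c1) c2) = c"
    and counit_right: "comult_sum C c (\<lambda>c1 c2. scl C (counit C c2) c1) = c"

locale hopf_algebra = coalgebra H
  for H :: "('k::field, 'h::ring_1, 'z) hopf_scheme" +
  assumes mult_bilinear: "bilinear_map (scl H) (scl H) (scl H) (*)"
    and comult_mult:
      "comult H (x * y) = comult_sum H x (\<lambda>x1 x2. comult_sum H y (\<lambda>y1 y2.
         (x1 * y1) \<otimes>\<^bsub>scl H,scl H\<^esub> (x2 * y2)))"
    and comult_one: "comult H 1 = 1 \<otimes>\<^bsub>scl H,scl H\<^esub> 1"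
    and counit_mult: "counit H (x * y) = counit H x * counit H y"
    and counit_one: "counit H 1 = 1"
    and antipode_linear: "Vector_Spaces.linear (scl H) (scl H) (antipode H)"
    and antipode_left: "comult_sum H x (\<lambda>x1 x2. antipode H x1 * x2) = scl H (counit H x) 1"
    and antipode_right: "comult_sum H x (\<lambda>x1 x2. x1 * antipode H x2) = scl H (counit H x) 1"

locale right_module_coalgebra = coalgebra C
  for H :: "('k::field, 'h::ring_1, 'z) hopf_scheme"
    and C :: "('k, 'h, 'c::ab_group_add, 'y) modcoalg_scheme" +
  assumes act_bilinear: "bilinear_map (scl C) (scl H) (scl C) (act C)"
    and act_one: "act C c 1 = c"
    and act_act: "act C (act C c g) h = act C c (g * h)"
    and comult_act:
      "comult C (act C c h) = comult_sum C c (\<lambda>c1 c2. comult_sum H h (\<lambda>h1 h2.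
         act C c1 h1 \<otimes>\<^bsub>scl C,scl C\<^esub> act C c2 h2))"
    and counit_act: "counit C (act C c h) = counit C c * counit H h"


section \<open>The category of right $H$-modules and right $C$-comodules\<close>

text \<open>The underlying vector space of \<open>M\<close> is a subspace \<open>mspace M\<close> of the ambient type \<open>'m\<close>.\<close>

record ('k, 'h, 'c, 'm) hmodule =
  mspace :: "'m set"
  mscl :: "'k \<Rightarrow> 'm \<Rightarrow> 'm"
  mact :: "'m \<Rightarrow> 'h \<Rightarrow> 'm"
  coact :: "'m \<Rightarrow> ('k, 'm, 'c) tensor"

abbreviation coact_sum ::
  "('k::field, 'c::ab_group_add, 'z) coalg_scheme \<Rightarrow>
   ('k, 'h, 'c, 'm::ab_group_add, 'y) hmodule_scheme \<Rightarrow> 'm \<Rightarrow>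
   ('m \<Rightarrow> 'c \<Rightarrow> 'v::ab_group_add) \<Rightarrow> 'v"
  where "coact_sum C M m \<equiv> sweedler (mscl M) (scl C) (mspace M) (coact M m)"

locale hopf_module =
  fixes H :: "('k::field, 'h::ring_1, 'z) hopf_scheme"
    and C :: "('k, 'h, 'c::ab_group_add, 'y) modcoalg_scheme"
    and M :: "('k, 'h, 'c, 'm::ab_group_add, 'x) hmodule_scheme"
  assumes mspace_ambient: "vector_space (mscl M)"
    and mspace_subspace: "module.subspace (mscl M) (mspace M)"
    and mact_in: "m \<in> mspace M \<Longrightarrow> mact M m h \<in> mspace M"
    and mact_linear: "m \<in> mspace M \<Longrightarrow> Vector_Spaces.linear (scl H) (mscl M) (mact M m)"
    and mact_add: "\<lbrakk>m \<in> mspace M; n \<in> mspace M\<rbrakk> \<Longrightarrow> mact M (m + n) h = mact M m h + mact M n h"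
    and mact_scale: "m \<in> mspace M \<Longrightarrow> mact M (mscl M a m) h = mscl M a (mact M m h)"
    and mact_one: "m \<in> mspace M \<Longrightarrow> mact M m 1 = m"
    and mact_mact: "m \<in> mspace M \<Longrightarrow> mact M (mact M m g) h = mact M m (g * h)"
    and coact_in: "m \<in> mspace M \<Longrightarrow> coact M m \<in> tensor_space (mscl M) (scl C) (mspace M)"
    and coact_add: "\<lbrakk>m \<in> mspace M; n \<in> mspace M\<rbrakk> \<Longrightarrow> coact M (m + n) = coact M m + coact M n"
    and coact_scale: "m \<in> mspace M \<Longrightarrow> coact M (mscl M a m) = pscale a (coact M m)"
    and coact_coassoc: "m \<in> mspace M \<Longrightarrow>
      coact_sum C M m (\<lambda>m0 m1. coact_sum C M m0 (\<lambda>m00 m01.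
         m00 \<otimes>\<^bsub>mscl M,pscale\<^esub> (m01 \<otimes>\<^bsub>scl C,scl C\<^esub> m1))) =
      coact_sum C M m (\<lambda>m0 m1. comult_sum C m1 (\<lambda>m11 m12.
         m0 \<otimes>\<^bsub>mscl M,pscale\<^esub> (m11 \<otimes>\<^bsub>scl C,scl C\<^esub> m12)))"
    and coact_counit: "m \<in> mspace M \<Longrightarrow>
      coact_sum C M m (\<lambda>m0 m1. mscl M (counit C m1) m0) = m"
    and coact_act: "m \<in> mspace M \<Longrightarrow>
      coact M (mact M m h) = coact_sum C M m (\<lambda>m0 m1. comult_sum H h (\<lambda>h1 h2.
         mact M m0 h1 \<otimes>\<^bsub>mscl M,scl C\<^esub> act C m1 h2))"


section \<open>Twistings\<close>

definition twist_hom ::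
  "('k::field, 'h::ring_1, 'z) hopf_scheme \<Rightarrow> ('k, 'h, 'c::ab_group_add, 'y) modcoalg_scheme \<Rightarrow>
   ('c \<Rightarrow> ('k, 'h, 'c) tensor) set"
  where "twist_hom H C = {\<tau>. Vector_Spaces.linear (scl C) pscale \<tau> \<and>
     (\<forall>c. \<tau> c \<in> tensor_space (scl H) (scl C) UNIV)}"

text \<open>\<open>twist_sum H C \<tau> c (\<lambda>h d. F h d)\<close> is \<open>F(c\<^sub>-\<^sub>1, c\<^sub>0)\<close> where \<open>\<tau>(c) = c\<^sub>-\<^sub>1 \<otimes> c\<^sub>0\<close>.\<close>

abbreviation twist_sum ::
  "('k::field, 'h::ring_1, 'z) hopf_scheme \<Rightarrow> ('k, 'h, 'c::ab_group_add, 'y) modcoalg_scheme \<Rightarrow>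
   ('c \<Rightarrow> ('k, 'h, 'c) tensor) \<Rightarrow> 'c \<Rightarrow> ('h \<Rightarrow> 'c \<Rightarrow> 'v::ab_group_add) \<Rightarrow> 'v"
  where "twist_sum H C \<tau> c \<equiv> sweedler (scl H) (scl C) UNIV (\<tau> c)"

definition twist_mult ::
  "('k::field, 'h::ring_1, 'z) hopf_scheme \<Rightarrow> ('k, 'h, 'c::ab_group_add, 'y) modcoalg_scheme \<Rightarrow>
   ('c \<Rightarrow> ('k, 'h, 'c) tensor) \<Rightarrow> ('c \<Rightarrow> ('k, 'h, 'c) tensor) \<Rightarrow> 'c \<Rightarrow> ('k, 'h, 'c) tensor"
  where "twist_mult H C \<tau> l = (\<lambda>c. twist_sum H C \<tau> c (\<lambda>h d. twist_sum H C l d (\<lambda>g e.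
     (h * g) \<otimes>\<^bsub>scl H,scl C\<^esub> e)))"

definition twist_one ::
  "('k::field, 'h::ring_1, 'z) hopf_scheme \<Rightarrow> ('k, 'h, 'c::ab_group_add, 'y) modcoalg_scheme \<Rightarrow>
   'c \<Rightarrow> ('k, 'h, 'c) tensor"
  where "twist_one H C = (\<lambda>c. 1 \<otimes>\<^bsub>scl H,scl C\<^esub> c)"

definition twist_invertible ::
  "('k::field, 'h::ring_1, 'z) hopf_scheme \<Rightarrow> ('k, 'h, 'c::ab_group_add, 'y) modcoalg_scheme \<Rightarrow>
   ('c \<Rightarrow> ('k, 'h, 'c) tensor) \<Rightarrow> bool"
  where "twist_invertible H C \<tau> \<longleftrightarrow> \<tau> \<in> twist_hom H C \<and>
     (\<exists>l \<in> twist_hom H C.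
        twist_mult H C \<tau> l = twist_one H C \<and> twist_mult H C l \<tau> = twist_one H C)"

definition normalized ::
  "('k::field, 'h::ring_1, 'z) hopf_scheme \<Rightarrow> ('k, 'h, 'c::ab_group_add, 'y) modcoalg_scheme \<Rightarrow>
   ('c \<Rightarrow> ('k, 'h, 'c) tensor) \<Rightarrow> bool"
  where "normalized H C \<tau> \<longleftrightarrow>
     (\<forall>c. twist_sum H C \<tau> c (\<lambda>h d. scl H (counit C d) h) = scl H (counit C c) 1) \<and>
     (\<forall>c. twist_sum H C \<tau> c (\<lambda>h d. scl C (counit H h) d) = c)"

definition twist_coalg ::
  "('k::field, 'h::ring_1, 'z) hopf_scheme \<Rightarrow> ('k, 'h, 'c::ab_group_add, 'y) modcoalg_scheme \<Rightarrow>
   ('c \<Rightarrow> ('k, 'h, 'c) tensor) \<Rightarrow> ('k, 'h, 'c, 'y) modcoalg_scheme"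
  where "twist_coalg H C \<tau> = C\<lparr>comult := \<lambda>c. comult_sum C c (\<lambda>c1 c2. twist_sum H C \<tau> c2 (\<lambda>h d.
     act C c1 h \<otimes>\<^bsub>scl C,scl C\<^esub> d))\<rparr>"

definition twist_module ::
  "('k::field, 'h::ring_1, 'z) hopf_scheme \<Rightarrow> ('k, 'h, 'c::ab_group_add, 'y) modcoalg_scheme \<Rightarrow>
   ('c \<Rightarrow> ('k, 'h, 'c) tensor) \<Rightarrow> ('k, 'h, 'c, 'm::ab_group_add, 'x) hmodule_scheme \<Rightarrow>
   ('k, 'h, 'c, 'm, 'x) hmodule_scheme"
  where "twist_module H C \<tau> M = M\<lparr>coact := \<lambda>m. coact_sum C M m (\<lambda>m0 m1. twist_sum H C \<tau> m1 (\<lambda>h d.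
     mact M m0 h \<otimes>\<^bsub>mscl M,scl C\<^esub> d))\<rparr>"

text \<open>
  HOL cannot quantify over types inside a formula, so \<open>M\<close> ranges over the objects whose underlying
  vector space is a subspace of the ambient type of \<open>H \<otimes> C\<close> (under any scalar multiplication
  on that type). This loses nothing: compatibility of the twist with the single object
  \<open>H \<otimes> C\<close>, with action \<open>(h \<otimes> c)\<cdot>g = hg\<^sub>1 \<otimes> c\<cdot>g\<^sub>2\<close> and coaction \<open>id \<otimes> \<Delta>\<close>, already implies
  the two defining identities of a twisting, and these give \<open>M\<^sup>\<tau>\<close> for every \<open>M\<close>.
\<close>

definition twisting ::
  "('k::field, 'h::ring_1, 'z) hopf_scheme \<Rightarrow> ('k, 'h, 'c::ab_group_add, 'y) modcoalg_scheme \<Rightarrow>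
   ('c \<Rightarrow> ('k, 'h, 'c) tensor) \<Rightarrow> bool"
  where "twisting H C \<tau> \<longleftrightarrow>
     \<tau> \<in> twist_hom H C \<and> normalized H C \<tau> \<and>
     right_module_coalgebra H (twist_coalg H C \<tau>) \<and>
     (\<forall>M :: ('k, 'h, 'c, ('k, 'h, 'c) tensor) hmodule.
        hopf_module H C M \<longrightarrow> hopf_module H (twist_coalg H C \<tau>) (twist_module H C \<tau> M))"

definition conv_invertible ::
  "('k::field, 'h::ring_1, 'z) hopf_scheme \<Rightarrow> ('k, 'h, 'c::ab_group_add, 'y) modcoalg_scheme \<Rightarrow>
   ('c \<Rightarrow> 'h) \<Rightarrow> bool"
  where "conv_invertible H C v \<longleftrightarrow> (\<exists>u. Vector_Spaces.linear (scl C) (scl H) u \<and>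
     (\<forall>c. comult_sum C c (\<lambda>c1 c2. v c1 * u c2) = scl H (counit C c) 1) \<and>
     (\<forall>c. comult_sum C c (\<lambda>c1 c2. u c1 * v c2) = scl H (counit C c) 1))"

definition twist_equiv ::
  "('k::field, 'h::ring_1, 'z) hopf_scheme \<Rightarrow> ('k, 'h, 'c::ab_group_add, 'y) modcoalg_scheme \<Rightarrow>
   ('c \<Rightarrow> ('k, 'h, 'c) tensor) \<Rightarrow> ('c \<Rightarrow> ('k, 'h, 'c) tensor) \<Rightarrow> bool"
  where "twist_equiv H C \<tau> l \<longleftrightarrow> (\<exists>v. Vector_Spaces.linear (scl C) (scl H) v \<and>
     conv_invertible H C v \<and>
     (\<forall>c. counit H (v c) = counit C c) \<and>
     (\<forall>c h. v (act C c h) = comult_sum H h (\<lambda>h1 h2. antipode H h1 * v c * h2)) \<and>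
     (\<forall>c. comult_sum C c (\<lambda>c1 c2. twist_sum H C l c1 (\<lambda>h d. comult_sum H (v c2) (\<lambda>v1 v2.
              (h * v1) \<otimes>\<^bsub>scl H,scl C\<^esub> act C d v2))) =
          comult_sum C c (\<lambda>c1 c2. twist_sum H C \<tau> c2 (\<lambda>h d. comult_sum C d (\<lambda>d1 d2.
              (v c1 * h) \<otimes>\<^bsub>scl H,scl C\<^esub> act C d1 (v d2))))))"

end

theory Submission
  imports Defs
begin

text \<open>
  The algebra \<open>Hom(C, H \<otimes> C)\<close> is the opposite of the algebra of left \<open>H\<close>-linear endomorphisms of
  \<open>H \<otimes> C\<close>: a map \<open>l\<close> extends to \<open>h \<otimes> c \<mapsto> h l(c)\<close> (\<open>extend\<close>), and \<open>\<tau> * \<lambda>\<close> is the restriction to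
  \<open>1 \<otimes> C\<close> of the extension of \<open>\<lambda>\<close> after the extension of \<open>\<tau>\<close>. Besides the left action, \<open>H \<otimes> C\<close>
  carries the diagonal right action \<open>(h \<otimes> c)k = hk\<^sub>1 \<otimes> c \<cdot> k\<^sub>2\<close> (\<open>rmult\<close>). The first of the two
  identities that characterise a twisting says exactly that its extension is right \<open>H\<close>-linear.

  Let \<open>v\<close> be the map of the equivalence. Three elements of the algebra are attached to it:
  \<open>A(c) = v(c\<^sub>1) \<otimes> c\<^sub>2\<close>, \<open>D(c) = 1 \<otimes> c\<^sub>1 \<cdot> v(c\<^sub>2)\<close> and \<open>E(c) = (1 \<otimes> c\<^sub>1)v(c\<^sub>2)\<close>, with the diagonal action in
  the last one (\<open>left_gauge\<close>, \<open>translate_gauge\<close>, \<open>right_gauge\<close>). Applying the extension of \<open>\<lambda>\<close> to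
  \<open>E(c)\<close> and using right linearity gives \<open>\<lambda>(c\<^sub>1)v(c\<^sub>2)\<close>, which is the left side of the equivalence
  relation; the right side is \<open>A * \<tau> * D\<close>. So the relation reads \<open>E * \<lambda> = A * \<tau> * D\<close>, and
  since \<open>\<tau>\<close> is invertible it suffices that \<open>A\<close>, \<open>D\<close> and \<open>E\<close> are.

  Their inverses are the elements attached in the same way to the convolution inverse \<open>u\<close> of \<open>v\<close>.
  For \<open>A\<close> this is coassociativity alone. For \<open>D\<close> and \<open>E\<close> one needs that \<open>c \<mapsto> c\<^sub>1 \<cdot> v(c\<^sub>2)\<close> and the
  extension of \<open>E\<close> are right \<open>H\<close>-linear, and likewise for \<open>u\<close>. The rule \<open>v(c \<cdot> h) = S(h\<^sub>1)v(c)h\<^sub>2\<close>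
  enters only through its antipode-free consequence \<open>h\<^sub>1 v(c \<cdot> h\<^sub>2) = v(c)h\<close> (\<open>equivariant\<close>), which
  yields this linearity and passes to \<open>u\<close>.

  The right linearity of the extension of \<open>\<lambda>\<close> is extracted from one relative Hopf module, \<open>H \<otimes> C\<close>
  with coaction \<open>id \<otimes> \<Delta>\<close>: it comes from the compatibility of the twisted coaction with the action
  after applying \<open>\<epsilon>\<close> to the middle factor (\<open>twisting_extend_rmult\<close>).
\<close>

section \<open>Linear and bilinear functions on tensor products\<close>

text \<open>
  Linearity is only required on \<open>V\<close>, because a function on a tensor product is evaluated through a
  choice of representation and need not be linear outside the span of the pure tensors. The
  definition mentions no axioms of scalar multiplication, so that linearity of a nested Sweedler
  expression in one of its variables is derived by following the syntax of the expression.
\<close>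

definition linear_on ::
  "('k \<Rightarrow> 'a::ab_group_add \<Rightarrow> 'a) \<Rightarrow> ('k \<Rightarrow> 'b::ab_group_add \<Rightarrow> 'b) \<Rightarrow> 'a set \<Rightarrow> ('a \<Rightarrow> 'b) \<Rightarrow> bool"
  where "linear_on sA sB V f \<longleftrightarrow>
    (\<forall>x\<in>V. \<forall>y\<in>V. f (x + y) = f x + f y) \<and> (\<forall>r. \<forall>x\<in>V. f (sA r x) = sB r (f x))"

definition bilinear_on ::
  "('k \<Rightarrow> 'a::ab_group_add \<Rightarrow> 'a) \<Rightarrow> ('k \<Rightarrow> 'b::ab_group_add \<Rightarrow> 'b) \<Rightarrow>
   ('k \<Rightarrow> 'w::ab_group_add \<Rightarrow> 'w) \<Rightarrow> 'a set \<Rightarrow> ('a \<Rightarrow> 'b \<Rightarrow> 'w) \<Rightarrow> bool"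
  where "bilinear_on sA sB sW V f \<longleftrightarrow>
    (\<forall>a\<in>V. linear_on sB sW UNIV (f a)) \<and> (\<forall>b. linear_on sA sW V (\<lambda>a. f a b))"

text \<open>
  For a fixed tensor every Sweedler sum runs over this one finite list, whatever the summand is. So
  linear maps may be moved into a Sweedler sum, and two such sums may be interchanged, with no
  bilinearity of the summand.
\<close>

definition tensor_rep ::
  "('k::field \<Rightarrow> 'a::ab_group_add \<Rightarrow> 'a) \<Rightarrow> ('k \<Rightarrow> 'b::ab_group_add \<Rightarrow> 'b) \<Rightarrow> 'a set \<Rightarrow>
   ('k, 'a, 'b) tensor \<Rightarrow> ('a \<times> 'b) list"
  where "tensor_rep sA sB V t =
    (SOME ps. set ps \<subseteq> V \<times> UNIV \<and> t = (\<Sum>(a, b)\<leftarrow>ps. a \<otimes>\<^bsub>sA,sB\<^esub> b))"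

lemma sweedler_rep: "sweedler sA sB V t f = (\<Sum>(a, b)\<leftarrow>tensor_rep sA sB V t. f a b)"
  by (simp add: sweedler_def tensor_rep_def)

lemma linear_onI [intro?]:
  assumes "\<And>x y. x \<in> V \<Longrightarrow> y \<in> V \<Longrightarrow> f (x + y) = f x + f y"
    and "\<And>r x. x \<in> V \<Longrightarrow> f (sA r x) = sB r (f x)"
  shows "linear_on sA sB V f"
  using assms by (simp add: linear_on_def)

lemma linear_on_add: "linear_on sA sB V f \<Longrightarrow> x \<in> V \<Longrightarrow> y \<in> V \<Longrightarrow> f (x + y) = f x + f y"
  and linear_on_scale: "linear_on sA sB V f \<Longrightarrow> x \<in> V \<Longrightarrow> f (sA r x) = sB r (f x)"
  by (simp_all add: linear_on_def)

lemma bilinear_onI: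
  assumes "\<And>a. a \<in> V \<Longrightarrow> linear_on sB sW UNIV (f a)"
    and "\<And>b. linear_on sA sW V (\<lambda>a. f a b)"
  shows "bilinear_on sA sB sW V f"
  using assms by (simp add: bilinear_on_def)

lemma linear_imp_linear_on: "Vector_Spaces.linear sA sB f \<Longrightarrow> linear_on sA sB V f"
  by (simp add: linear_on_def Vector_Spaces.linear_iff)

lemma linear_on_imp_linear:
  "vector_space sA \<Longrightarrow> vector_space sB \<Longrightarrow> linear_on sA sB UNIV f \<Longrightarrow> Vector_Spaces.linear sA sB f"
  by (simp add: linear_on_def Vector_Spaces.linear_iff)

lemma linear_on_zero:
  assumes "linear_on sA sB V f" "0 \<in> V"
  shows "f 0 = 0"
  using linear_on_add[OF assms(1,2,2)] by simp

lemma linear_on_ident: "linear_on sA sA V (\<lambda>x. x)"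
  by (simp add: linear_on_def)

lemma linear_on_compose:
  assumes "linear_on sB sW UNIV f" "linear_on sA sB V g"
  shows "linear_on sA sW V (\<lambda>x. f (g x))"
  using assms by (simp add: linear_on_def)

lemma linear_on_tens_left:
  assumes "vector_space sA" "vector_space sB" "linear_on s sA V f"
  shows "linear_on s pscale V (\<lambda>x. f x \<otimes>\<^bsub>sA,sB\<^esub> b)"
  using bilinear_map_tens[OF assms(1,2)] assms(3)
  by (auto simp: linear_on_def bilinear_map_def Vector_Spaces.linear_iff)

lemma linear_on_tens_right:
  assumes "vector_space sA" "vector_space sB" "linear_on s sB V f"
  shows "linear_on s pscale V (\<lambda>x. a \<otimes>\<^bsub>sA,sB\<^esub> f x)"
  using bilinear_map_tens[OF assms(1,2)] assms(3)
  by (auto simp: linear_on_def bilinear_map_def Vector_Spaces.linear_iff)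

lemma linear_on_scale_left:
  assumes "vector_space sB" "linear_on s (*) V f"
  shows "linear_on s sB V (\<lambda>x. sB (f x) b)"
  using assms by (simp add: linear_on_def vector_space_def)

lemma linear_on_scale_right:
  assumes "vector_space sB" "linear_on s sB V f"
  shows "linear_on s sB V (\<lambda>x. sB r (f x))"
  using assms by (simp add: linear_on_def vector_space_def mult.commute)

lemma sweedler_cong_UNIV:
  assumes "\<And>a b. f a b = g a b"
  shows "sweedler sA sB V t f = sweedler sA sB V t g"
  using assms by (simp add: sweedler_rep)

lemma linear_on_sweedler_fun:
  assumes W: "vector_space sW" and f: "\<And>a b. linear_on sA sW V (\<lambda>x. f x a b)"
  shows "linear_on sA sW V (\<lambda>x. sweedler s1 s2 U t (f x))"
proof -
  interpret W: vector_space sW by fact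
  have "(\<Sum>(a, b)\<leftarrow>ps. f (x + y) a b) = (\<Sum>(a, b)\<leftarrow>ps. f x a b) + (\<Sum>(a, b)\<leftarrow>ps. f y a b)"
    if "x \<in> V" "y \<in> V" for x y ps
    using that f by (induction ps) (auto simp: linear_on_def)
  moreover have "(\<Sum>(a, b)\<leftarrow>ps. f (sA r x) a b) = sW r (\<Sum>(a, b)\<leftarrow>ps. f x a b)"
    if "x \<in> V" for r x ps
    using that f by (induction ps) (auto simp: linear_on_def W.scale_right_distrib)
  ultimately show ?thesis by (simp add: linear_on_def sweedler_rep)
qed

lemma linear_on_apply_sweedler:
  assumes "linear_on sA sB UNIV L"
  shows "L (sweedler s1 s2 U t f) = sweedler s1 s2 U t (\<lambda>a b. L (f a b))"
proof -
  have "L (\<Sum>(a, b)\<leftarrow>ps. f a b) = (\<Sum>(a, b)\<leftarrow>ps. L (f a b))" for ps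
    by (induction ps) (auto simp: linear_on_zero[OF assms] linear_on_add[OF assms])
  then show ?thesis by (simp add: sweedler_rep)
qed

lemma sweedler_swap:
  "sweedler s1 s2 U t (\<lambda>a b. sweedler s3 s4 V s (\<lambda>c d. f a b c d)) =
   sweedler s3 s4 V s (\<lambda>c d. sweedler s1 s2 U t (\<lambda>a b. f a b c d))"
proof -
  have "(\<Sum>(a, b)\<leftarrow>ps. \<Sum>(c, d)\<leftarrow>qs. f a b c d) = (\<Sum>(c, d)\<leftarrow>qs. \<Sum>(a, b)\<leftarrow>ps. f a b c d)" for ps qs
    by (induction ps) (auto simp: case_prod_unfold sum_list_addf)
  then show ?thesis by (simp add: sweedler_rep)
qed

lemma tensor_rep:
  assumes "vector_space sA" "vector_space sB" "module.subspace sA V" "t \<in> tensor_space sA sB V"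
  shows "set (tensor_rep sA sB V t) \<subseteq> V \<times> UNIV"
    and "t = (\<Sum>(a, b)\<leftarrow>tensor_rep sA sB V t. a \<otimes>\<^bsub>sA,sB\<^esub> b)"
  using someI_ex[of "\<lambda>ps. set ps \<subseteq> V \<times> UNIV \<and> t = (\<Sum>(a, b)\<leftarrow>ps. a \<otimes>\<^bsub>sA,sB\<^esub> b)"]
    assms tensor_space_iff[OF assms(1-3)] unfolding tensor_rep_def by blast+

lemma sweedler_cong_on:
  assumes "vector_space sA" "vector_space sB" "module.subspace sA V" "t \<in> tensor_space sA sB V"
    and "\<And>a b. a \<in> V \<Longrightarrow> f a b = g a b"
  shows "sweedler sA sB V t f = sweedler sA sB V t g"
  unfolding sweedler_rep using tensor_rep(1)[OF assms(1-4)] assms(5)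
  by (intro arg_cong[where f = sum_list] map_cong) auto

lemma sweedler_tens_ident:
  assumes "vector_space sA" "vector_space sB" "module.subspace sA V" "t \<in> tensor_space sA sB V"
  shows "sweedler sA sB V t (\<lambda>a b. a \<otimes>\<^bsub>sA,sB\<^esub> b) = t"
  using tensor_rep(2)[OF assms] by (simp add: sweedler_rep)

text \<open>
  A variant for maps that are only linear on a subspace \<open>W\<close>, such as Sweedler sums regarded as
  functions of the tensor.
\<close>

lemma linear_on_apply_sweedler_on:
  assumes L: "linear_on sW sX W L" and W: "vector_space sW" "module.subspace sW W"
    and t: "vector_space sA" "vector_space sB" "module.subspace sA V" "t \<in> tensor_space sA sB V"
    and f: "\<And>a b. a \<in> V \<Longrightarrow> f a b \<in> W"
  shows "L (sweedler sA sB V t f) = sweedler sA sB V t (\<lambda>a b. L (f a b))"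
proof -
  interpret W: vector_space sW by fact
  have 0: "0 \<in> W" by (rule W.subspace_0[OF W(2)])
  have "(\<Sum>(a, b)\<leftarrow>ps. f a b) \<in> W \<and> L (\<Sum>(a, b)\<leftarrow>ps. f a b) = (\<Sum>(a, b)\<leftarrow>ps. L (f a b))"
    if "set ps \<subseteq> V \<times> UNIV" for ps
    using that
  proof (induction ps)
    case Nil
    show ?case using linear_on_zero[OF L 0] 0 by simp
  next
    case (Cons p ps)
    then show ?case using f
      by (auto simp: linear_on_add[OF L] W.subspace_add[OF W(2)])
  qed
  with tensor_rep(1)[OF t] show ?thesis by (simp add: sweedler_rep)
qed

lemma sweedler_in:
  assumes W: "vector_space sW" "module.subspace sW W"
    and t: "vector_space sA" "vector_space sB" "module.subspace sA V" "t \<in> tensor_space sA sB V"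
    and f: "\<And>a b. a \<in> V \<Longrightarrow> f a b \<in> W"
  shows "sweedler sA sB V t f \<in> W"
proof -
  interpret W: vector_space sW by fact
  have "(\<Sum>(a, b)\<leftarrow>ps. f a b) \<in> W" if "set ps \<subseteq> V \<times> UNIV" for ps
    using that f by (induction ps) (auto simp: W.subspace_0[OF W(2)] W.subspace_add[OF W(2)])
  with tensor_rep(1)[OF t] show ?thesis by (simp add: sweedler_rep)
qed

lemma subspace_tensor_space: "module.subspace pscale (tensor_space sA sB V)"
proof -
  interpret P: vector_space pscale by (rule vector_space_pscale)
  show ?thesis unfolding tensor_space_def by (rule P.subspace_span)
qed

lemma tens_in_tensor_space: "a \<in> V \<Longrightarrow> a \<otimes>\<^bsub>sA,sB\<^esub> b \<in> tensor_space sA sB V"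
proof -
  interpret P: vector_space pscale by (rule vector_space_pscale)
  show "a \<in> V \<Longrightarrow> a \<otimes>\<^bsub>sA,sB\<^esub> b \<in> tensor_space sA sB V"
    unfolding tensor_space_def by (rule P.span_base) blast
qed

lemma sweedler_eq_sum:
  assumes A: "vector_space sA" and B: "vector_space sB" and W: "vector_space sW"
    and V: "module.subspace sA V" and f: "bilinear_on sA sB sW V f"
    and ps: "set ps \<subseteq> V \<times> UNIV" "t = (\<Sum>(a, b)\<leftarrow>ps. a \<otimes>\<^bsub>sA,sB\<^esub> b)"
  shows "sweedler sA sB V t f = (\<Sum>(a, b)\<leftarrow>ps. f a b)"
  using f by (intro sweedler_eq[OF A B W V ps])
    (auto simp: bilinear_on_def linear_on_def Vector_Spaces.linear_iff A B W)

lemma sweedler_tens: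
  assumes "vector_space sA" "vector_space sB" "vector_space sW" "module.subspace sA V"
    and "bilinear_on sA sB sW V f" "a \<in> V"
  shows "sweedler sA sB V (a \<otimes>\<^bsub>sA,sB\<^esub> b) f = f a b"
  using sweedler_eq_sum[OF assms(1-5), of "[(a, b)]"] assms(6) by simp

lemma linear_on_sweedler:
  assumes A: "vector_space sA" and B: "vector_space sB" and W: "vector_space sW"
    and V: "module.subspace sA V" and f: "bilinear_on sA sB sW V f"
  shows "linear_on pscale sW (tensor_space sA sB V) (\<lambda>t. sweedler sA sB V t f)"
proof
  interpret A: vector_space sA by fact
  interpret W: vector_space sW by fact
  interpret P: vector_space pscale by (rule vector_space_pscale)
  note rep = tensor_rep[OF A B V] and eq = sweedler_eq_sum[OF A B W V f]
  fix t s assume ts: "t \<in> tensor_space sA sB V" "s \<in> tensor_space sA sB V"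
  show "sweedler sA sB V (t + s) f = sweedler sA sB V t f + sweedler sA sB V s f"
    using eq[of "tensor_rep sA sB V t @ tensor_rep sA sB V s" "t + s"] rep[OF ts(1)] rep[OF ts(2)]
    by (simp add: sweedler_rep)
next
  interpret A: vector_space sA by fact
  interpret W: vector_space sW by fact
  interpret P: vector_space pscale by (rule vector_space_pscale)
  note rep = tensor_rep[OF A B V] and eq = sweedler_eq_sum[OF A B W V f]
  fix r t assume t: "t \<in> tensor_space sA sB V"
  define qs where "qs = map (\<lambda>(a, b). (sA r a, b)) (tensor_rep sA sB V t)"
  have "set qs \<subseteq> V \<times> UNIV"
    using rep(1)[OF t] A.subspace_scale[OF V] by (auto simp: qs_def)
  moreover have "(\<Sum>(a, b)\<leftarrow>map (\<lambda>(a, b). (sA r a, b)) ps. a \<otimes>\<^bsub>sA,sB\<^esub> b) =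
      pscale r (\<Sum>(a, b)\<leftarrow>ps. a \<otimes>\<^bsub>sA,sB\<^esub> b)" for ps
    using linear_on_scale[OF linear_on_tens_left[OF A B linear_on_ident]]
    by (induction ps) (auto simp: P.scale_right_distrib simp del: plus_fun_apply)
  then have "pscale r t = (\<Sum>(a, b)\<leftarrow>qs. a \<otimes>\<^bsub>sA,sB\<^esub> b)"
    using rep(2)[OF t] by (metis qs_def)
  moreover have "(\<Sum>(a, b)\<leftarrow>map (\<lambda>(a, b). (sA r a, b)) ps. f a b) = sW r (\<Sum>(a, b)\<leftarrow>ps. f a b)"
    if "set ps \<subseteq> V \<times> UNIV" for ps
    using that f by (induction ps) (auto simp: bilinear_on_def linear_on_def W.scale_right_distrib)
  ultimately show "sweedler sA sB V (pscale r t) f = sW r (sweedler sA sB V t f)"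
    using eq[of qs "pscale r t"] rep(1)[OF t] by (simp add: qs_def sweedler_rep)
qed

lemma linear_on_sweedler_arg:
  assumes "vector_space sA" "vector_space sB" "vector_space sW"
    and "module.subspace sA V" "bilinear_on sA sB sW V f"
    and "linear_on s pscale U g" "\<And>x. x \<in> U \<Longrightarrow> g x \<in> tensor_space sA sB V"
  shows "linear_on s sW U (\<lambda>x. sweedler sA sB V (g x) f)"
  using linear_on_sweedler[OF assms(1-5)] assms(6,7) by (simp add: linear_on_def)

text \<open>
  A Sweedler sum over a tensor that is itself given by a Sweedler sum; this is how iterated Sweedler
  notation is evaluated.
\<close>

lemma sweedler_sweedler:
  assumes W: "vector_space sW"
    and A: "vector_space sA" "vector_space sB" "module.subspace sA V" and f: "bilinear_on sA sB sW V f"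
    and t: "vector_space sC" "vector_space sD" "module.subspace sC U" "t \<in> tensor_space sC sD U"
    and g: "\<And>a b. a \<in> U \<Longrightarrow> g a b \<in> tensor_space sA sB V"
  shows "sweedler sA sB V (sweedler sC sD U t g) f = sweedler sC sD U t (\<lambda>a b. sweedler sA sB V (g a b) f)"
  by (rule linear_on_apply_sweedler_on[OF linear_on_sweedler[OF A(1,2) W A(3) f]
        vector_space_pscale subspace_tensor_space t g])

lemma tensor_space_ext:
  assumes "linear_on pscale sW (tensor_space sA sB V) f" "linear_on pscale sW (tensor_space sA sB V) g"
    and A: "vector_space sA" "vector_space sB" "module.subspace sA V" "t \<in> tensor_space sA sB V"
    and "\<And>a b. a \<in> V \<Longrightarrow> f (a \<otimes>\<^bsub>sA,sB\<^esub> b) = g (a \<otimes>\<^bsub>sA,sB\<^esub> b)"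
  shows "f t = g t"
proof -
  have *: "h t = sweedler sA sB V t (\<lambda>a b. h (a \<otimes>\<^bsub>sA,sB\<^esub> b))"
    if "linear_on pscale sW (tensor_space sA sB V) h" for h
    using linear_on_apply_sweedler_on[OF that vector_space_pscale subspace_tensor_space A
        tens_in_tensor_space, of "\<lambda>a b. a" "\<lambda>a b. b"]
    by (simp add: sweedler_tens_ident[OF A])
  show ?thesis
    unfolding *[OF assms(1)] *[OF assms(2)] by (rule sweedler_cong_on[OF A assms(7)])
qed

lemma subspace_UNIV_vs: "vector_space s \<Longrightarrow> module.subspace s UNIV"
  by (simp add: module.subspace_UNIV module_iff_vector_space)

context coalgebra begin

lemma lin_comult: "linear_on (scl C) pscale V (comult C)"
  by (rule linear_imp_linear_on[OF comult_linear])

lemma lin_counit: "linear_on (scl C) (*) V (counit C)"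
  by (rule linear_imp_linear_on[OF counit_linear])

lemma subspace_UNIV: "module.subspace (scl C) UNIV"
  by (rule subspace_UNIV_vs[OF vector_space])

text \<open>
  The coassociativity axiom is an equation between elements of \<open>C \<otimes> (C \<otimes> C)\<close>. A trilinear \<open>f\<close> is
  a bilinear function on \<open>C \<times> (C \<otimes> C)\<close>; precomposing with a projection onto \<open>C \<otimes> C\<close> makes it
  bilinear on the whole ambient type, where the axiom can be evaluated.
\<close>

lemma comult_sum_comult_sum:
  assumes W: "vector_space sW"
    and f: "\<And>b d. linear_on (scl C) sW UNIV (\<lambda>a. f a b d)"
      "\<And>a d. linear_on (scl C) sW UNIV (\<lambda>b. f a b d)"
      "\<And>a b. linear_on (scl C) sW UNIV (\<lambda>d. f a b d)"
  shows "comult_sum C c (\<lambda>c1 c2. comult_sum C c1 (\<lambda>c11 c12. f c11 c12 c2)) =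
    comult_sum C c (\<lambda>c1 c2. comult_sum C c2 (\<lambda>c21 c22. f c1 c21 c22))"
proof -
  note vs = vector_space and U = subspace_UNIV and P = vector_space_pscale
  define T where "T = tensor_space (scl C) (scl C) UNIV"
  obtain p where p: "Vector_Spaces.linear pscale pscale p" "\<And>t. p t \<in> T" "\<And>t. t \<in> T \<Longrightarrow> p t = t"
    using linear_projection_exists[OF P subspace_tensor_space[of "scl C" "scl C" UNIV]] unfolding T_def by blast
  define g where "g a t = sweedler (scl C) (scl C) UNIV (p t) (f a)" for a t
  have bf: "bilinear_on (scl C) (scl C) sW UNIV (f a)" for a
    by (intro bilinear_onI f)
  have g: "bilinear_on (scl C) pscale sW UNIV g"
    unfolding g_def
    by (intro bilinear_onI linear_on_sweedler_arg linear_on_sweedler_fun W vs U bf f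
        linear_imp_linear_on[OF p(1)] p(2)[unfolded T_def])
  have gt: "sweedler (scl C) pscale UNIV (a \<otimes>\<^bsub>scl C,pscale\<^esub> (b \<otimes>\<^bsub>scl C,scl C\<^esub> d)) g = f a b d" for a b d
  proof -
    have "sweedler (scl C) pscale UNIV (a \<otimes>\<^bsub>scl C,pscale\<^esub> (b \<otimes>\<^bsub>scl C,scl C\<^esub> d)) g = g a (b \<otimes>\<^bsub>scl C,scl C\<^esub> d)"
      by (rule sweedler_tens[OF vs P W U g]) simp
    also have "p (b \<otimes>\<^bsub>scl C,scl C\<^esub> d) = b \<otimes>\<^bsub>scl C,scl C\<^esub> d"
      by (intro p(3)) (simp add: T_def tens_in_tensor_space)
    then have "g a (b \<otimes>\<^bsub>scl C,scl C\<^esub> d) = f a b d"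
      unfolding g_def by (simp add: sweedler_tens[OF vs vs W U bf])
    finally show ?thesis .
  qed
  note bind = sweedler_sweedler[OF W vs P U g vs vs U comult_in]
  have in1: "comult_sum C c1 (\<lambda>c11 c12. c11 \<otimes>\<^bsub>scl C,pscale\<^esub> (c12 \<otimes>\<^bsub>scl C,scl C\<^esub> c2))
      \<in> tensor_space (scl C) pscale UNIV" for c1 c2
    by (intro sweedler_in[OF P subspace_tensor_space vs vs U comult_in] tens_in_tensor_space) simp
  have in2: "comult_sum C c2 (\<lambda>c21 c22. c1 \<otimes>\<^bsub>scl C,pscale\<^esub> (c21 \<otimes>\<^bsub>scl C,scl C\<^esub> c22))
      \<in> tensor_space (scl C) pscale UNIV" for c1 c2
    by (intro sweedler_in[OF P subspace_tensor_space vs vs U comult_in] tens_in_tensor_space) simp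
  show ?thesis
    using arg_cong[OF coassoc[of c], where f = "\<lambda>t. sweedler (scl C) pscale UNIV t g"]
    by (simp add: bind in1 in2 tens_in_tensor_space gt)
qed

lemma comult_sum_counit_left:
  assumes "linear_on (scl C) sW UNIV f"
  shows "comult_sum C c (\<lambda>c1 c2. sW (counit C c1) (f c2)) = f c"
  using linear_on_apply_sweedler[OF assms, of "scl C" "scl C" UNIV "comult C c" "\<lambda>c1 c2. scl C (counit C c1) c2"]
  by (simp add: counit_left linear_on_scale[OF assms])

lemma comult_sum_counit_right:
  assumes "linear_on (scl C) sW UNIV f"
  shows "comult_sum C c (\<lambda>c1 c2. sW (counit C c2) (f c1)) = f c"
  using linear_on_apply_sweedler[OF assms, of "scl C" "scl C" UNIV "comult C c" "\<lambda>c1 c2. scl C (counit C c2) c1"]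
  by (simp add: counit_right linear_on_scale[OF assms])

end


section \<open>Left linear endomorphisms of $H \otimes C$\<close>

locale hopf_module_coalgebra = H: hopf_algebra H + right_module_coalgebra H C
  for H :: "('k::field, 'h::ring_1, 'z) hopf_scheme"
    and C :: "('k, 'h, 'c::ab_group_add, 'y) modcoalg_scheme"
begin

abbreviation pure_tensor :: "'h \<Rightarrow> 'c \<Rightarrow> ('k, 'h, 'c) tensor" (infixl "\<otimes>" 75)
  where "h \<otimes> c \<equiv> h \<otimes>\<^bsub>scl H,scl C\<^esub> c"

abbreviation HC :: "('k, 'h, 'c) tensor set"
  where "HC \<equiv> tensor_space (scl H) (scl C) UNIV"

abbreviation tensor_sum :: "('k, 'h, 'c) tensor \<Rightarrow> ('h \<Rightarrow> 'c \<Rightarrow> 'v::ab_group_add) \<Rightarrow> 'v"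
  where "tensor_sum t \<equiv> sweedler (scl H) (scl C) UNIV t"

abbreviation cact :: "'c \<Rightarrow> 'h \<Rightarrow> 'c" (infixl "\<cdot>" 80)
  where "c \<cdot> h \<equiv> act C c h"

lemmas vs = H.vector_space vector_space vector_space_pscale vector_space_field
lemmas sub = H.subspace_UNIV subspace_UNIV

lemma lin_mult:
  "linear_on s (scl H) V f \<Longrightarrow> linear_on s (scl H) V (\<lambda>x. f x * h)"
  "linear_on s (scl H) V f \<Longrightarrow> linear_on s (scl H) V (\<lambda>x. h * f x)"
  using H.mult_bilinear by (auto simp: linear_on_def bilinear_map_def Vector_Spaces.linear_iff)

lemma lin_act:
  "linear_on s (scl C) V f \<Longrightarrow> linear_on s (scl C) V (\<lambda>x. f x \<cdot> h)"
  "linear_on s (scl H) V g \<Longrightarrow> linear_on s (scl C) V (\<lambda>x. c \<cdot> g x)"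
  using act_bilinear by (auto simp: linear_on_def bilinear_map_def Vector_Spaces.linear_iff)

lemma lin_comp:
  "linear_on s (scl H) V g \<Longrightarrow> linear_on s pscale V (\<lambda>x. comult H (g x))"
  "linear_on s (scl C) V f \<Longrightarrow> linear_on s pscale V (\<lambda>x. comult C (f x))"
  "linear_on s (scl H) V g \<Longrightarrow> linear_on s (*) V (\<lambda>x. counit H (g x))"
  "linear_on s (scl C) V f \<Longrightarrow> linear_on s (*) V (\<lambda>x. counit C (f x))"
  "linear_on s (scl H) V g \<Longrightarrow> linear_on s (scl H) V (\<lambda>x. antipode H (g x))"
  using linear_on_compose H.lin_comult lin_comult H.lin_counit lin_counit
    linear_imp_linear_on[OF H.antipode_linear] by blast+

text \<open>
  The scalar multiplications are fixed here because a schematic one in an introduction rule would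
  unify with every binary function.
\<close>

lemmas lin_scale =
  linear_on_scale_left[OF vs(1)] linear_on_scale_left[OF vs(2)] linear_on_scale_left[OF vs(3)]
  linear_on_scale_right[OF vs(1)] linear_on_scale_right[OF vs(2)] linear_on_scale_right[OF vs(3)]

lemmas lin_intros = linear_on_ident lin_mult lin_act lin_comp linear_on_tens_left linear_on_tens_right
  lin_scale linear_on_sweedler_fun linear_on_sweedler_arg vs sub
  subspace_tensor_space bilinear_onI H.comult_in comult_in tens_in_tensor_space UNIV_I

lemma HC_sums [simp]:
  "(\<And>a b. g a b \<in> HC) \<Longrightarrow> comult_sum H k g \<in> HC"
  "(\<And>a b. g' a b \<in> HC) \<Longrightarrow> comult_sum C c g' \<in> HC"
  by (auto intro!: sweedler_in[OF vs(3) subspace_tensor_space] lin_intros)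

lemma HC_tensor_sum [simp]: "t \<in> HC \<Longrightarrow> (\<And>a b. g a b \<in> HC) \<Longrightarrow> tensor_sum t g \<in> HC"
  by (intro sweedler_in[OF vs(3) subspace_tensor_space] lin_intros)

lemma HC_tens [simp]: "h \<otimes> c \<in> HC"
  by (intro lin_intros)

lemma apply_on_HC:
  assumes "linear_on pscale sW HC L"
  shows "(\<And>a b. g a b \<in> HC) \<Longrightarrow> L (comult_sum H k g) = comult_sum H k (\<lambda>a b. L (g a b))"
    and "(\<And>a b. g' a b \<in> HC) \<Longrightarrow> L (comult_sum C c g') = comult_sum C c (\<lambda>a b. L (g' a b))"
    and "t \<in> HC \<Longrightarrow> (\<And>a b. g'' a b \<in> HC) \<Longrightarrow> L (tensor_sum t g'') = tensor_sum t (\<lambda>a b. L (g'' a b))"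
  by (intro linear_on_apply_sweedler_on[OF assms] lin_intros; simp)+

lemma HC_ext:
  assumes "linear_on pscale pscale HC f" "linear_on pscale pscale HC g" "t \<in> HC"
    and "\<And>h c. f (h \<otimes> c) = g (h \<otimes> c)"
  shows "f t = g t"
  by (rule tensor_space_ext[OF assms(1,2) vs(1,2) sub(1) assms(3,4)])

lemma tensor_sum_tens:
  "vector_space sW \<Longrightarrow> bilinear_on (scl H) (scl C) sW UNIV f \<Longrightarrow> tensor_sum (h \<otimes> c) f = f h c"
  by (rule sweedler_tens[OF vs(1,2) _ sub(1)]) auto

lemma comult_sum_act:
  assumes W: "vector_space sW" and f: "\<And>b. linear_on (scl C) sW UNIV (\<lambda>a. f a b)"
     "\<And>a. linear_on (scl C) sW UNIV (\<lambda>b. f a b)"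
  shows "comult_sum C (c \<cdot> h) f =
    comult_sum C c (\<lambda>c1 c2. comult_sum H h (\<lambda>h1 h2. f (c1 \<cdot> h1) (c2 \<cdot> h2)))"
proof -
  have bf: "bilinear_on (scl C) (scl C) sW UNIV f" by (intro bilinear_onI f)
  have summand: "comult_sum H h (\<lambda>y1 y2. x1 \<cdot> y1 \<otimes>\<^bsub>scl C,scl C\<^esub> x2 \<cdot> y2)
      \<in> tensor_space (scl C) (scl C) UNIV" for x1 x2
    by (intro sweedler_in[OF vs(3)] lin_intros)
  show ?thesis unfolding comult_act
    by (simp add: summand tens_in_tensor_space sweedler_tens[OF vs(2,2) W sub(2) bf]
        sweedler_sweedler[OF W vs(2,2) sub(2) bf vs(2,2) sub(2) comult_in]
        sweedler_sweedler[OF W vs(2,2) sub(2) bf vs(1,1) sub(1) H.comult_in])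
qed

lemma comult_sum_mult:
  assumes W: "vector_space sW" and f: "\<And>b. linear_on (scl H) sW UNIV (\<lambda>a. f a b)"
     "\<And>a. linear_on (scl H) sW UNIV (\<lambda>b. f a b)"
  shows "comult_sum H (g * h) f =
    comult_sum H g (\<lambda>g1 g2. comult_sum H h (\<lambda>h1 h2. f (g1 * h1) (g2 * h2)))"
proof -
  have bf: "bilinear_on (scl H) (scl H) sW UNIV f" by (intro bilinear_onI f)
  have summand: "comult_sum H h (\<lambda>y1 y2. (x1 * y1) \<otimes>\<^bsub>scl H,scl H\<^esub> (x2 * y2))
      \<in> tensor_space (scl H) (scl H) UNIV" for x1 x2
    by (intro sweedler_in[OF vs(3)] lin_intros)
  show ?thesis unfolding H.comult_mult
    by (simp add: summand tens_in_tensor_space sweedler_tens[OF vs(1,1) W sub(1) bf]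
        sweedler_sweedler[OF W vs(1,1) sub(1) bf vs(1,1) sub(1) H.comult_in]
        sweedler_sweedler[OF W vs(1,1) sub(1) bf vs(1,1) sub(1) H.comult_in])
qed

lemma comult_sum_one:
  assumes W: "vector_space sW" and f: "\<And>b. linear_on (scl H) sW UNIV (\<lambda>a. f a b)"
     "\<And>a. linear_on (scl H) sW UNIV (\<lambda>b. f a b)"
  shows "comult_sum H 1 f = f 1 1"
  unfolding H.comult_one by (intro sweedler_tens[OF vs(1,1) W sub(1)] bilinear_onI f UNIV_I)

definition lmult :: "'h \<Rightarrow> ('k, 'h, 'c) tensor \<Rightarrow> ('k, 'h, 'c) tensor"
  where "lmult h t = tensor_sum t (\<lambda>g d. (h * g) \<otimes> d)"

definition rmult :: "('k, 'h, 'c) tensor \<Rightarrow> 'h \<Rightarrow> ('k, 'h, 'c) tensor"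
  where "rmult t k = tensor_sum t (\<lambda>h d. comult_sum H k (\<lambda>k1 k2. (h * k1) \<otimes> (d \<cdot> k2)))"

text \<open>
  The left \<open>H\<close>-linear endomorphism of \<open>H \<otimes> C\<close> whose restriction to \<open>1 \<otimes> C\<close> is \<open>l\<close>.
\<close>

definition extend :: "('c \<Rightarrow> ('k, 'h, 'c) tensor) \<Rightarrow> ('k, 'h, 'c) tensor \<Rightarrow> ('k, 'h, 'c) tensor"
  where "extend l t = tensor_sum t (\<lambda>h d. tensor_sum (l d) (\<lambda>g e. (h * g) \<otimes> e))"

lemma lmult_in [simp]: "t \<in> HC \<Longrightarrow> lmult h t \<in> HC"
  by (simp add: lmult_def)

lemma rmult_in [simp]: "t \<in> HC \<Longrightarrow> rmult t k \<in> HC"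
  by (simp add: rmult_def)

lemma lmult_tens [simp]: "lmult h (g \<otimes> c) = (h * g) \<otimes> c"
  unfolding lmult_def by (intro tensor_sum_tens[OF vs(3)] lin_intros)

lemma rmult_tens: "rmult (h \<otimes> c) k = comult_sum H k (\<lambda>k1 k2. (h * k1) \<otimes> (c \<cdot> k2))"
  unfolding rmult_def by (intro tensor_sum_tens[OF vs(3)] lin_intros)

lemma lin_lmult:
  "linear_on s (scl H) V f \<Longrightarrow> linear_on s pscale V (\<lambda>x. lmult (f x) t)"
  "linear_on s pscale V g \<Longrightarrow> (\<And>x. x \<in> V \<Longrightarrow> g x \<in> HC) \<Longrightarrow> linear_on s pscale V (\<lambda>x. lmult h (g x))"
  unfolding lmult_def by (intro lin_intros; simp)+

lemma lin_rmult:
  "linear_on s (scl H) V f \<Longrightarrow> linear_on s pscale V (\<lambda>x. rmult t (f x))"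
  "linear_on s pscale V g \<Longrightarrow> (\<And>x. x \<in> V \<Longrightarrow> g x \<in> HC) \<Longrightarrow> linear_on s pscale V (\<lambda>x. rmult (g x) k)"
  unfolding rmult_def by (intro lin_intros; simp)+

lemma lmult_lmult:
  assumes "t \<in> HC" shows "lmult g (lmult h t) = lmult (g * h) t"
  by (rule HC_ext[OF _ _ assms]; (intro lin_lmult lin_intros)?; simp add: mult.assoc)

lemma lmult_one:
  assumes "t \<in> HC" shows "lmult 1 t = t"
  by (rule HC_ext[OF _ _ assms, where g = "\<lambda>t. t"]; (intro lin_lmult lin_intros)?; simp)

lemma lmult_sums:
  "(\<And>a b. g a b \<in> HC) \<Longrightarrow> lmult h (comult_sum H k g) = comult_sum H k (\<lambda>a b. lmult h (g a b))"
  "(\<And>a b. g' a b \<in> HC) \<Longrightarrow> lmult h (comult_sum C c g') = comult_sum C c (\<lambda>a b. lmult h (g' a b))"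
  "t \<in> HC \<Longrightarrow> (\<And>a b. g'' a b \<in> HC) \<Longrightarrow> lmult h (tensor_sum t g'') = tensor_sum t (\<lambda>a b. lmult h (g'' a b))"
  using apply_on_HC[OF lin_lmult(2)[OF linear_on_ident]] by auto

lemma rmult_sums:
  "(\<And>a b. g a b \<in> HC) \<Longrightarrow> rmult (comult_sum H k' g) k = comult_sum H k' (\<lambda>a b. rmult (g a b) k)"
  "(\<And>a b. g' a b \<in> HC) \<Longrightarrow> rmult (comult_sum C c g') k = comult_sum C c (\<lambda>a b. rmult (g' a b) k)"
  "t \<in> HC \<Longrightarrow> (\<And>a b. g'' a b \<in> HC) \<Longrightarrow> rmult (tensor_sum t g'') k = tensor_sum t (\<lambda>a b. rmult (g'' a b) k)"
  using apply_on_HC[OF lin_rmult(2)[OF linear_on_ident]] by auto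

lemma rmult_right_sum: "rmult t (sweedler s1 s2 U s f) = sweedler s1 s2 U s (\<lambda>a b. rmult t (f a b))"
  by (rule linear_on_apply_sweedler[OF lin_rmult(1)[OF linear_on_ident]])

lemma lmult_rmult:
  assumes "t \<in> HC" shows "lmult h (rmult t k) = rmult (lmult h t) k"
  by (rule HC_ext[OF _ _ assms]; (intro lin_lmult lin_rmult lin_intros)?;
      simp add: rmult_tens lmult_sums mult.assoc)

lemma rmult_rmult:
  assumes "t \<in> HC" shows "rmult (rmult t g) k = rmult t (g * k)"
proof (rule HC_ext[OF _ _ assms])
  fix h c
  have "rmult (h \<otimes> c) (g * k) =
      comult_sum H g (\<lambda>g1 g2. comult_sum H k (\<lambda>k1 k2. (h * (g1 * k1)) \<otimes> (c \<cdot> (g2 * k2))))"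
    unfolding rmult_tens by (intro comult_sum_mult[OF vs(3)] lin_intros)
  then show "rmult (rmult (h \<otimes> c) g) k = rmult (h \<otimes> c) (g * k)"
    by (simp add: rmult_tens rmult_sums act_act mult.assoc)
qed (intro lin_rmult lin_intros; simp)+

lemma rmult_one:
  assumes "t \<in> HC" shows "rmult t 1 = t"
proof (rule HC_ext[OF _ _ assms, where g = "\<lambda>t. t"])
  fix h c
  have "rmult (h \<otimes> c) 1 = (h * 1) \<otimes> (c \<cdot> 1)"
    unfolding rmult_tens by (intro comult_sum_one[OF vs(3)] lin_intros)
  then show "rmult (h \<otimes> c) 1 = h \<otimes> c" by (simp add: act_one)
qed (intro lin_rmult lin_intros; simp)+

lemma twist_homI:
  "linear_on (scl C) pscale UNIV l \<Longrightarrow> (\<And>c. l c \<in> HC) \<Longrightarrow> l \<in> twist_hom H C"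
  by (simp add: twist_hom_def linear_on_imp_linear[OF vs(2,3)])

lemma twist_hom_in [simp]: "l \<in> twist_hom H C \<Longrightarrow> l c \<in> HC"
  by (simp add: twist_hom_def)

lemma lin_twist_hom:
  assumes "l \<in> twist_hom H C" "linear_on s (scl C) V f"
  shows "linear_on s pscale V (\<lambda>x. l (f x))"
proof -
  have "linear_on (scl C) pscale UNIV l"
    using assms(1) unfolding twist_hom_def by (intro linear_imp_linear_on) blast
  then show ?thesis using assms(2) by (rule linear_on_compose)
qed

lemma extend_in [simp]: "l \<in> twist_hom H C \<Longrightarrow> t \<in> HC \<Longrightarrow> extend l t \<in> HC"
  by (simp add: extend_def)

lemma extend_tens [simp]:
  assumes "l \<in> twist_hom H C" shows "extend l (h \<otimes> c) = lmult h (l c)"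
  unfolding extend_def lmult_def
  by (intro tensor_sum_tens[OF vs(3)] lin_intros lin_twist_hom[OF assms] twist_hom_in[OF assms])

lemma lin_extend:
  assumes "l \<in> twist_hom H C"
  shows "linear_on s pscale V g \<Longrightarrow> (\<And>x. x \<in> V \<Longrightarrow> g x \<in> HC) \<Longrightarrow> linear_on s pscale V (\<lambda>x. extend l (g x))"
  unfolding extend_def by (intro lin_intros lin_twist_hom[OF assms] twist_hom_in[OF assms]; simp)

lemma extend_sums:
  assumes "l \<in> twist_hom H C"
  shows "(\<And>a b. g a b \<in> HC) \<Longrightarrow> extend l (comult_sum H k' g) = comult_sum H k' (\<lambda>a b. extend l (g a b))"
  "(\<And>a b. g' a b \<in> HC) \<Longrightarrow> extend l (comult_sum C c g') = comult_sum C c (\<lambda>a b. extend l (g' a b))"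
  "t \<in> HC \<Longrightarrow> (\<And>a b. g'' a b \<in> HC) \<Longrightarrow> extend l (tensor_sum t g'') = tensor_sum t (\<lambda>a b. extend l (g'' a b))"
  using apply_on_HC[OF lin_extend[OF assms linear_on_ident]] by auto

text \<open>
  The product of \<open>Hom(C, H \<otimes> C)\<close> is composition of extensions in the opposite order; the algebra
  laws follow from this.
\<close>

lemma twist_mult_eq: "twist_mult H C a b c = extend b (a c)"
  by (simp add: twist_mult_def extend_def)

lemma extend_lmult:
  assumes "l \<in> twist_hom H C" "t \<in> HC" shows "extend l (lmult h t) = lmult h (extend l t)"
  by (rule HC_ext[OF _ _ assms(2)]; (intro lin_lmult lin_extend assms(1) lin_intros)?;
      simp add: assms lmult_lmult)

lemma twist_mult_hom:
  assumes "a \<in> twist_hom H C" "b \<in> twist_hom H C" shows "twist_mult H C a b \<in> twist_hom H C"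
  unfolding twist_mult_eq[abs_def]
  by (rule twist_homI) (simp_all add: assms lin_extend lin_twist_hom[OF assms(1) linear_on_ident])

lemma extend_twist_mult:
  assumes "a \<in> twist_hom H C" "b \<in> twist_hom H C" "t \<in> HC"
  shows "extend (twist_mult H C a b) t = extend b (extend a t)"
proof (rule HC_ext[OF _ _ assms(3)])
  note ab = twist_mult_hom[OF assms(1,2)]
  fix h c
  show "extend (twist_mult H C a b) (h \<otimes> c) = extend b (extend a (h \<otimes> c))"
    using extend_tens[OF ab] assms by (simp add: twist_mult_eq extend_lmult)
qed (intro lin_extend assms twist_mult_hom linear_on_ident; simp add: assms)+

lemma twist_mult_assoc:
  assumes "a \<in> twist_hom H C" "b \<in> twist_hom H C" "c \<in> twist_hom H C"
  shows "twist_mult H C (twist_mult H C a b) c = twist_mult H C a (twist_mult H C b c)"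
  by (simp add: fun_eq_iff twist_mult_eq extend_twist_mult assms)

lemma twist_one_hom: "twist_one H C \<in> twist_hom H C"
  unfolding twist_one_def by (intro twist_homI lin_intros)

lemma twist_mult_one:
  assumes "a \<in> twist_hom H C"
  shows "twist_mult H C (twist_one H C) a = a" "twist_mult H C a (twist_one H C) = a"
proof -
  have "extend (twist_one H C) t = t" if "t \<in> HC" for t
    by (rule HC_ext[OF _ _ that, where g = "\<lambda>t. t"]; (intro lin_extend twist_one_hom lin_intros)?;
      simp add: twist_one_hom) (simp add: twist_one_def)
  then show "twist_mult H C (twist_one H C) a = a" "twist_mult H C a (twist_one H C) = a"
    using assms by (simp_all add: fun_eq_iff twist_mult_eq) (simp add: twist_one_def lmult_one)
qed

lemma twist_invertible_mult:
  assumes "twist_invertible H C a" "twist_invertible H C b"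
  shows "twist_invertible H C (twist_mult H C a b)"
proof -
  obtain a' where a: "a \<in> twist_hom H C" "a' \<in> twist_hom H C"
    "twist_mult H C a a' = twist_one H C" "twist_mult H C a' a = twist_one H C"
    using assms(1) unfolding twist_invertible_def by blast
  obtain b' where b: "b \<in> twist_hom H C" "b' \<in> twist_hom H C"
    "twist_mult H C b b' = twist_one H C" "twist_mult H C b' b = twist_one H C"
    using assms(2) unfolding twist_invertible_def by blast
  have "twist_mult H C (twist_mult H C a b) (twist_mult H C b' a') = twist_one H C"
    using a b by (metis twist_mult_assoc twist_mult_hom twist_mult_one(1))
  moreover have "twist_mult H C (twist_mult H C b' a') (twist_mult H C a b) = twist_one H C"
    using a b by (metis twist_mult_assoc twist_mult_hom twist_mult_one(1))
  ultimately show ?thesis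
    using a b twist_mult_hom unfolding twist_invertible_def by blast
qed

lemma mult_scale: "g * scl H r h = scl H r (g * h)" "scl H r g * h = scl H r (g * h)"
  by (rule linear_on_scale[OF lin_mult(2)[OF linear_on_ident] UNIV_I]
      linear_on_scale[OF lin_mult(1)[OF linear_on_ident] UNIV_I])+

lemma mult_sum: "(g :: 'h) * sweedler s1 s2 U t f = sweedler s1 s2 U t (\<lambda>a b. g * f a b)"
    "sweedler s1 s2 U t f * g = sweedler s1 s2 U t (\<lambda>a b. f a b * g)"
  by (rule linear_on_apply_sweedler[OF lin_mult(2)[OF linear_on_ident]]
      linear_on_apply_sweedler[OF lin_mult(1)[OF linear_on_ident]])+

lemma scale_sum: "scl H r (sweedler s1 s2 U t f) = sweedler s1 s2 U t (\<lambda>a b. scl H r (f a b))"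
  by (rule linear_on_apply_sweedler[OF linear_on_scale_right[OF vs(1) linear_on_ident]])

lemma act_sum: "c \<cdot> sweedler s1 s2 U t f = sweedler s1 s2 U t (\<lambda>a b. c \<cdot> f a b)"
    "sweedler s1 s2 U t f' \<cdot> g = sweedler s1 s2 U t (\<lambda>a b. f' a b \<cdot> g)"
  by (rule linear_on_apply_sweedler[OF lin_act(2)[OF linear_on_ident]]
      linear_on_apply_sweedler[OF lin_act(1)[OF linear_on_ident]])+

lemma tens_sum: "h \<otimes> sweedler s1 s2 U t f = sweedler s1 s2 U t (\<lambda>a b. h \<otimes> f a b)"
    "sweedler s1 s2 U t f' \<otimes> c = sweedler s1 s2 U t (\<lambda>a b. f' a b \<otimes> c)"
  by (rule linear_on_apply_sweedler[OF linear_on_tens_right[OF vs(1,2) linear_on_ident]]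
      linear_on_apply_sweedler[OF linear_on_tens_left[OF vs(1,2) linear_on_ident]])+

lemma lin_scale_simps: "scl H r g \<otimes> c = pscale r (g \<otimes> c)" "h \<otimes> scl C r d = pscale r (h \<otimes> d)"
  "d \<cdot> scl H r h = scl C r (d \<cdot> h)" "rmult t (scl H r h) = pscale r (rmult t h)"
  by (rule linear_on_scale[OF linear_on_tens_left[OF vs(1,2) linear_on_ident] UNIV_I]
      linear_on_scale[OF linear_on_tens_right[OF vs(1,2) linear_on_ident] UNIV_I]
      linear_on_scale[OF lin_act(2)[OF linear_on_ident] UNIV_I]
      linear_on_scale[OF lin_rmult(1)[OF linear_on_ident] UNIV_I])+


section \<open>Invertible elements attached to an equivariant map\<close>

text \<open>
  This is the form of the rule \<open>w(c \<cdot> k) = S(k\<^sub>1)w(c)k\<^sub>2\<close> in which the antipode has been moved to the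
  other side. In this form the rule visibly passes to convolution inverses, and it says how \<open>w(c)k\<close>
  is rewritten when right linearity is proved.
\<close>

definition equivariant :: "('c \<Rightarrow> 'h) \<Rightarrow> bool"
  where "equivariant w \<longleftrightarrow> linear_on (scl C) (scl H) UNIV w \<and>
    (\<forall>c k. comult_sum H k (\<lambda>k1 k2. k1 * w (c \<cdot> k2)) = w c * k)"

lemma lin_equivariant:
  assumes "equivariant w" "linear_on s (scl C) V f"
  shows "linear_on s (scl H) V (\<lambda>x. w (f x))"
  using assms linear_on_compose unfolding equivariant_def by blast

lemma equivariant_sum: "equivariant w \<Longrightarrow> comult_sum H k (\<lambda>k1 k2. k1 * w (c \<cdot> k2)) = w c * k"
  by (simp add: equivariant_def)

text \<open>
  \<open>k\<^sub>1 v(c \<cdot> k\<^sub>2) = k\<^sub>1 S(k\<^sub>2)v(c)k\<^sub>3 = v(c)k\<close>.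
\<close>

lemma equivariant_if_conjugation:
  assumes v: "Vector_Spaces.linear (scl C) (scl H) v"
    and eq: "\<And>c h. v (c \<cdot> h) = comult_sum H h (\<lambda>h1 h2. antipode H h1 * v c * h2)"
  shows "equivariant v"
  unfolding equivariant_def
proof (intro conjI allI)
  fix c k
  have "comult_sum H k (\<lambda>k1 k2. k1 * v (c \<cdot> k2)) =
      comult_sum H k (\<lambda>k1 k2. comult_sum H k2 (\<lambda>k21 k22. k1 * antipode H k21 * (v c * k22)))"
    by (simp add: eq mult_sum mult.assoc)
  also have "\<dots> = comult_sum H k (\<lambda>k1 k2. comult_sum H k1 (\<lambda>k11 k12. k11 * antipode H k12 * (v c * k2)))"
    by (rule H.comult_sum_comult_sum[OF vs(1), symmetric]; intro lin_intros)
  also have "\<dots> = comult_sum H k (\<lambda>k1 k2. scl H (counit H k1) (v c * k2))"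
    by (simp add: mult_sum(2)[symmetric] H.antipode_right mult_scale)
  also have "\<dots> = v c * k"
    by (intro H.comult_sum_counit_left lin_intros)
  finally show "comult_sum H k (\<lambda>k1 k2. k1 * v (c \<cdot> k2)) = v c * k" .
qed (rule linear_imp_linear_on[OF v])

text \<open>
  Write \<open>q(c) = k\<^sub>1 u(c \<cdot> k\<^sub>2)\<close>. Equivariance of \<open>v\<close> and multiplicativity of \<open>\<Delta>\<close> on \<open>c \<cdot> k\<close> give
  \<open>v(c\<^sub>1)q(c\<^sub>2) = k\<^sub>1 v(c\<^sub>1 \<cdot> k\<^sub>2)u(c\<^sub>2 \<cdot> k\<^sub>3) = \<epsilon>(c)k\<close>. Convolving with \<open>u\<close> from the left leaves \<open>q(c) = u(c)k\<close>.
\<close>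

lemma equivariant_conv_inverse:
  assumes v: "equivariant v" and u: "linear_on (scl C) (scl H) UNIV u"
    and vu: "\<And>c. comult_sum C c (\<lambda>c1 c2. v c1 * u c2) = scl H (counit C c) 1"
    and uv: "\<And>c. comult_sum C c (\<lambda>c1 c2. u c1 * v c2) = scl H (counit C c) 1"
  shows "equivariant u"
proof -
  note lin_u = linear_on_compose[OF u] and lin_v = lin_equivariant[OF v]
  define q where "q c k = comult_sum H k (\<lambda>k1 k2. k1 * u (c \<cdot> k2))" for c k
  have lin_q: "linear_on s (scl C) V f \<Longrightarrow> linear_on s (scl H) V (\<lambda>x. q (f x) k)" for s f k and V :: "'x::ab_group_add set"
    unfolding q_def by (intro lin_intros lin_u)
  have vq: "comult_sum C c (\<lambda>c1 c2. v c1 * q c2 k) = scl H (counit C c) k" for c k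
  proof -
    have "comult_sum C c (\<lambda>c1 c2. v c1 * q c2 k) =
        comult_sum C c (\<lambda>c1 c2. comult_sum H k (\<lambda>k1 k2. (v c1 * k1) * u (c2 \<cdot> k2)))"
      by (simp add: q_def mult_sum mult.assoc)
    also have "\<dots> = comult_sum C c (\<lambda>c1 c2. comult_sum H k (\<lambda>k1 k2. comult_sum H k1 (\<lambda>k11 k12.
        k11 * v (c1 \<cdot> k12) * u (c2 \<cdot> k2))))"
      by (simp add: equivariant_sum[OF v, symmetric] mult_sum)
    also have "\<dots> = comult_sum C c (\<lambda>c1 c2. comult_sum H k (\<lambda>k1 k2. comult_sum H k2 (\<lambda>k21 k22.
        k1 * v (c1 \<cdot> k21) * u (c2 \<cdot> k22))))"
      by (intro sweedler_cong_UNIV H.comult_sum_comult_sum[OF vs(1)] lin_intros lin_u lin_v)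
    also have "\<dots> = comult_sum H k (\<lambda>k1 k2. comult_sum C c (\<lambda>c1 c2. comult_sum H k2 (\<lambda>k21 k22.
        k1 * v (c1 \<cdot> k21) * u (c2 \<cdot> k22))))"
      by (rule sweedler_swap)
    also have "\<dots> = comult_sum H k (\<lambda>k1 k2. k1 * comult_sum C (c \<cdot> k2) (\<lambda>d1 d2. v d1 * u d2))"
    proof (rule sweedler_cong_UNIV)
      fix k1 k2
      have "comult_sum C (c \<cdot> k2) (\<lambda>d1 d2. v d1 * u d2) =
          comult_sum C c (\<lambda>c1 c2. comult_sum H k2 (\<lambda>k21 k22. v (c1 \<cdot> k21) * u (c2 \<cdot> k22)))"
        by (intro comult_sum_act[OF vs(1)] lin_intros lin_u lin_v)
      then show "comult_sum C c (\<lambda>c1 c2. comult_sum H k2 (\<lambda>k21 k22.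
          k1 * v (c1 \<cdot> k21) * u (c2 \<cdot> k22))) = k1 * comult_sum C (c \<cdot> k2) (\<lambda>d1 d2. v d1 * u d2)"
        by (simp add: mult_sum mult.assoc)
    qed
    also have "\<dots> = scl H (counit C c) (comult_sum H k (\<lambda>k1 k2. scl H (counit H k2) k1))"
      by (simp add: vu counit_act mult_scale scale_sum vector_space.vector_space_assms(3)[OF vs(1)])
    finally show ?thesis by (simp add: H.counit_right)
  qed
  have "q c k = u c * k" for c k
  proof -
    have "q c k = comult_sum C c (\<lambda>c1 c2. scl H (counit C c1) (q c2 k))"
      by (rule comult_sum_counit_left[symmetric]) (intro lin_q linear_on_ident)
    also have "\<dots> = comult_sum C c (\<lambda>c1 c2. comult_sum C c1 (\<lambda>c11 c12. u c11 * v c12 * q c2 k))"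
      by (simp add: mult_sum(2)[symmetric] uv mult_scale)
    also have "\<dots> = comult_sum C c (\<lambda>c1 c2. comult_sum C c2 (\<lambda>c21 c22. u c1 * v c21 * q c22 k))"
      by (intro comult_sum_comult_sum[OF vs(1)] lin_intros lin_u lin_v lin_q)
    also have "\<dots> = comult_sum C c (\<lambda>c1 c2. scl H (counit C c2) (u c1 * k))"
      by (simp add: mult.assoc mult_sum(1)[symmetric] vq mult_scale)
    also have "\<dots> = u c * k"
      by (intro comult_sum_counit_right lin_intros lin_u)
    finally show ?thesis .
  qed
  with u show ?thesis by (simp add: equivariant_def q_def)
qed

definition left_gauge :: "('c \<Rightarrow> 'h) \<Rightarrow> 'c \<Rightarrow> ('k, 'h, 'c) tensor"
  where "left_gauge w c = comult_sum C c (\<lambda>c1 c2. w c1 \<otimes> c2)"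

definition translate :: "('c \<Rightarrow> 'h) \<Rightarrow> 'c \<Rightarrow> 'c"
  where "translate w c = comult_sum C c (\<lambda>c1 c2. c1 \<cdot> w c2)"

definition translate_gauge :: "('c \<Rightarrow> 'h) \<Rightarrow> 'c \<Rightarrow> ('k, 'h, 'c) tensor"
  where "translate_gauge w c = 1 \<otimes> translate w c"

definition right_gauge :: "('c \<Rightarrow> 'h) \<Rightarrow> 'c \<Rightarrow> ('k, 'h, 'c) tensor"
  where "right_gauge w c = comult_sum C c (\<lambda>c1 c2. rmult (1 \<otimes> c1) (w c2))"

lemma lin_translate:
  assumes "equivariant w" "linear_on s (scl C) V f"
  shows "linear_on s (scl C) V (\<lambda>x. translate w (f x))"
  unfolding translate_def by (intro lin_intros lin_equivariant[OF assms(1)] assms(2))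

lemma gauge_hom:
  assumes "equivariant w"
  shows "left_gauge w \<in> twist_hom H C" "translate_gauge w \<in> twist_hom H C" "right_gauge w \<in> twist_hom H C"
proof -
  show "left_gauge w \<in> twist_hom H C" unfolding left_gauge_def[abs_def]
    by (rule twist_homI, (intro lin_intros lin_equivariant[OF assms])[1], simp)
  show "translate_gauge w \<in> twist_hom H C" unfolding translate_gauge_def[abs_def]
    by (rule twist_homI, (intro lin_intros lin_translate[OF assms])[1], simp)
  show "right_gauge w \<in> twist_hom H C" unfolding right_gauge_def[abs_def]
    by (rule twist_homI, (intro lin_intros lin_rmult lin_equivariant[OF assms] HC_tens)[1], simp)
qed

text \<open>
  The product sends \<open>c\<close> to \<open>v(c\<^sub>1)u(c\<^sub>2) \<otimes> c\<^sub>3 = 1 \<otimes> c\<close>.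
\<close>

lemma left_gauge_mult:
  assumes v: "equivariant v" and u: "equivariant u"
    and vu: "\<And>c. comult_sum C c (\<lambda>c1 c2. v c1 * u c2) = scl H (counit C c) 1"
  shows "twist_mult H C (left_gauge v) (left_gauge u) = twist_one H C"
proof
  fix c
  note lins = lin_equivariant[OF u] lin_equivariant[OF v]
  have "twist_mult H C (left_gauge v) (left_gauge u) c =
      comult_sum C c (\<lambda>c1 c2. comult_sum C c2 (\<lambda>c21 c22. (v c1 * u c21) \<otimes> c22))"
    by (simp add: twist_mult_eq left_gauge_def[of v] extend_sums gauge_hom[OF u])
       (simp add: left_gauge_def lmult_sums)
  also have "\<dots> = comult_sum C c (\<lambda>c1 c2. comult_sum C c1 (\<lambda>c11 c12. (v c11 * u c12) \<otimes> c2))"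
    by (rule comult_sum_comult_sum[OF vs(3), symmetric]; intro lin_intros lins)
  also have "\<dots> = comult_sum C c (\<lambda>c1 c2. pscale (counit C c1) (1 \<otimes> c2))"
    by (simp add: tens_sum(2)[symmetric] vu lin_scale_simps)
  also have "\<dots> = twist_one H C c"
    unfolding twist_one_def by (intro comult_sum_counit_left lin_intros)
  finally show "twist_mult H C (left_gauge v) (left_gauge u) c = twist_one H C c" .
qed

lemma translate_act:
  assumes "equivariant w"
  shows "translate w (c \<cdot> k) = translate w c \<cdot> k"
proof -
  have "translate w (c \<cdot> k) =
      comult_sum C c (\<lambda>c1 c2. comult_sum H k (\<lambda>k1 k2. c1 \<cdot> k1 \<cdot> w (c2 \<cdot> k2)))"
    unfolding translate_def by (intro comult_sum_act[OF vs(2)] lin_intros lin_equivariant[OF assms])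
  also have "\<dots> = translate w c \<cdot> k"
    by (simp add: act_act act_sum(1)[symmetric] equivariant_sum[OF assms])
       (simp add: translate_def act_sum(2) act_act)
  finally show ?thesis .
qed

text \<open>
  Since the translation by \<open>u\<close> is right \<open>H\<close>-linear, it maps \<open>c\<^sub>1 \<cdot> v(c\<^sub>2)\<close> to
  \<open>c\<^sub>1 \<cdot> u(c\<^sub>2)v(c\<^sub>3) = c\<close>.
\<close>

lemma translate_inverse:
  assumes v: "equivariant v" and u: "equivariant u"
    and uv: "\<And>c. comult_sum C c (\<lambda>c1 c2. u c1 * v c2) = scl H (counit C c) 1"
  shows "translate u (translate v c) = c"
proof -
  note lins = lin_equivariant[OF u] lin_equivariant[OF v]
  have "translate u (translate v c) = comult_sum C c (\<lambda>c1 c2. translate u (c1 \<cdot> v c2))"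
    unfolding translate_def[of v]
    by (rule linear_on_apply_sweedler[OF lin_translate[OF u linear_on_ident]])
  also have "\<dots> = comult_sum C c (\<lambda>c1 c2. comult_sum C c1 (\<lambda>c11 c12. c11 \<cdot> (u c12 * v c2)))"
    by (simp add: translate_act[OF u]) (simp add: translate_def act_sum act_act)
  also have "\<dots> = comult_sum C c (\<lambda>c1 c2. comult_sum C c2 (\<lambda>c21 c22. c1 \<cdot> (u c21 * v c22)))"
    by (rule comult_sum_comult_sum[OF vs(2)]; intro lin_intros lins)
  also have "\<dots> = comult_sum C c (\<lambda>c1 c2. scl C (counit C c2) c1)"
    by (simp add: act_sum(1)[symmetric] uv lin_scale_simps act_one)
  finally show ?thesis by (simp add: counit_right)
qed

lemma translate_gauge_mult:
  assumes v: "equivariant v" and u: "equivariant u"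
    and uv: "\<And>c. comult_sum C c (\<lambda>c1 c2. u c1 * v c2) = scl H (counit C c) 1"
  shows "twist_mult H C (translate_gauge v) (translate_gauge u) = twist_one H C"
  by (simp add: fun_eq_iff twist_mult_eq translate_gauge_def[of v] gauge_hom[OF u])
     (simp add: translate_gauge_def twist_one_def translate_inverse[OF v u uv])

text \<open>
  The hypothesis \<open>eq\<close> is the identity \<open>c\<^sub>-\<^sub>1k\<^sub>1 \<otimes> c\<^sub>0 \<cdot> k\<^sub>2 = k\<^sub>1(c \<cdot> k\<^sub>2)\<^sub>-\<^sub>1 \<otimes> (c \<cdot> k\<^sub>2)\<^sub>0\<close> for \<open>l\<close>, that is, right
  linearity of the extension on \<open>1 \<otimes> C\<close>. It spreads to \<open>H \<otimes> C\<close> because the left and right actions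
  commute.
\<close>

lemma extend_rmult:
  assumes l: "l \<in> twist_hom H C"
    and eq: "\<And>c k. rmult (l c) k = comult_sum H k (\<lambda>k1 k2. lmult k1 (l (c \<cdot> k2)))"
    and t: "t \<in> HC"
  shows "extend l (rmult t k) = rmult (extend l t) k"
proof (rule HC_ext[OF _ _ t])
  fix h c
  show "extend l (rmult (h \<otimes> c) k) = rmult (extend l (h \<otimes> c)) k"
    by (simp add: l rmult_tens extend_sums lmult_rmult[symmetric] eq lmult_sums lmult_lmult)
qed (intro lin_extend[OF l] lin_rmult linear_on_ident; simp add: l)+

text \<open>
  On \<open>1 \<otimes> c\<close>: by equivariance
  \<open>E(c)k = (1 \<otimes> c\<^sub>1)w(c\<^sub>2)k = (1 \<otimes> c\<^sub>1)k\<^sub>1w(c\<^sub>2 \<cdot> k\<^sub>2) = k\<^sub>1((1 \<otimes> c\<^sub>1 \<cdot> k\<^sub>2)w(c\<^sub>2 \<cdot> k\<^sub>3)) = k\<^sub>1E(c \<cdot> k\<^sub>2)\<close>.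
\<close>

lemma extend_right_gauge_rmult:
  assumes w: "equivariant w" and t: "t \<in> HC"
  shows "extend (right_gauge w) (rmult t k) = rmult (extend (right_gauge w) t) k"
proof (rule extend_rmult[OF gauge_hom(3)[OF w] _ t])
  fix c k
  note lins = lin_equivariant[OF w]
  have "rmult (right_gauge w c) k = comult_sum C c (\<lambda>c1 c2. rmult (1 \<otimes> c1) (w c2 * k))"
    by (simp add: right_gauge_def rmult_sums rmult_rmult)
  also have "\<dots> = comult_sum C c (\<lambda>c1 c2. comult_sum H k (\<lambda>k1 k2. rmult (rmult (1 \<otimes> c1) k1) (w (c2 \<cdot> k2))))"
    by (simp add: equivariant_sum[OF w, symmetric] rmult_right_sum rmult_rmult)
  also have "\<dots> = comult_sum C c (\<lambda>c1 c2. comult_sum H k (\<lambda>k1 k2. comult_sum H k1 (\<lambda>k11 k12.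
      rmult (k11 \<otimes> (c1 \<cdot> k12)) (w (c2 \<cdot> k2)))))"
    by (simp add: rmult_tens[of 1] rmult_sums)
  also have "\<dots> = comult_sum C c (\<lambda>c1 c2. comult_sum H k (\<lambda>k1 k2. comult_sum H k2 (\<lambda>k21 k22.
      rmult (k1 \<otimes> (c1 \<cdot> k21)) (w (c2 \<cdot> k22)))))"
    by (intro sweedler_cong_UNIV H.comult_sum_comult_sum[OF vs(3)] lin_rmult lin_intros lins)
  also have "\<dots> = comult_sum H k (\<lambda>k1 k2. comult_sum C c (\<lambda>c1 c2. comult_sum H k2 (\<lambda>k21 k22.
      rmult (k1 \<otimes> (c1 \<cdot> k21)) (w (c2 \<cdot> k22)))))"
    by (rule sweedler_swap)
  also have "\<dots> = comult_sum H k (\<lambda>k1 k2. lmult k1 (right_gauge w (c \<cdot> k2)))"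
  proof (rule sweedler_cong_UNIV)
    fix k1 k2
    have "right_gauge w (c \<cdot> k2) = comult_sum C c (\<lambda>c1 c2. comult_sum H k2 (\<lambda>k21 k22.
        rmult (1 \<otimes> (c1 \<cdot> k21)) (w (c2 \<cdot> k22))))"
      unfolding right_gauge_def
      by (intro comult_sum_act[OF vs(3)] lin_rmult lin_intros lins)
    then show "comult_sum C c (\<lambda>c1 c2. comult_sum H k2 (\<lambda>k21 k22.
        rmult (k1 \<otimes> (c1 \<cdot> k21)) (w (c2 \<cdot> k22)))) = lmult k1 (right_gauge w (c \<cdot> k2))"
      by (simp add: lmult_sums lmult_rmult)
  qed
  finally show "rmult (right_gauge w c) k = comult_sum H k (\<lambda>k1 k2. lmult k1 (right_gauge w (c \<cdot> k2)))" .
qed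

text \<open>
  A right linear extension of \<open>l\<close> is evaluated on \<open>E(c) = (1 \<otimes> c\<^sub>1)v(c\<^sub>2)\<close> inside the right action. With
  the twisting \<open>\<lambda>\<close> as \<open>l\<close> the result is the left side of the equivalence relation.
\<close>

lemma right_gauge_sum: "l \<in> twist_hom H C \<Longrightarrow>
  (\<And>t k. t \<in> HC \<Longrightarrow> extend l (rmult t k) = rmult (extend l t) k) \<Longrightarrow>
  twist_mult H C (right_gauge v) l c = comult_sum C c (\<lambda>c1 c2. rmult (l c1) (v c2))"
  by (simp add: twist_mult_eq right_gauge_def extend_sums lmult_one)

text \<open>
  The extension of \<open>right_gauge u\<close> is right linear, so it maps \<open>(1 \<otimes> c\<^sub>1)v(c\<^sub>2)\<close> to
  \<open>(1 \<otimes> c\<^sub>1)u(c\<^sub>2)v(c\<^sub>3) = 1 \<otimes> c\<close>.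
\<close>

lemma right_gauge_mult:
  assumes v: "equivariant v" and u: "equivariant u"
    and uv: "\<And>c. comult_sum C c (\<lambda>c1 c2. u c1 * v c2) = scl H (counit C c) 1"
  shows "twist_mult H C (right_gauge v) (right_gauge u) = twist_one H C"
proof
  fix c
  note lins = lin_equivariant[OF u] lin_equivariant[OF v]
  have "twist_mult H C (right_gauge v) (right_gauge u) c =
      comult_sum C c (\<lambda>c1 c2. comult_sum C c1 (\<lambda>c11 c12. rmult (1 \<otimes> c11) (u c12 * v c2)))"
    by (simp add: right_gauge_sum gauge_hom[OF u] extend_right_gauge_rmult[OF u])
       (simp add: right_gauge_def rmult_sums rmult_rmult)
  also have "\<dots> = comult_sum C c (\<lambda>c1 c2. comult_sum C c2 (\<lambda>c21 c22. rmult (1 \<otimes> c1) (u c21 * v c22)))"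
    by (rule comult_sum_comult_sum[OF vs(3)]; intro lin_rmult lin_intros lins HC_tens)
  also have "\<dots> = comult_sum C c (\<lambda>c1 c2. pscale (counit C c2) (1 \<otimes> c1))"
    by (simp add: rmult_right_sum[symmetric] uv lin_scale_simps rmult_one)
  also have "\<dots> = twist_one H C c"
    unfolding twist_one_def by (intro comult_sum_counit_right lin_intros)
  finally show "twist_mult H C (right_gauge v) (right_gauge u) c = twist_one H C c" .
qed

text \<open>
  The right side of the equivalence relation is \<open>A * \<tau> * D\<close>.
\<close>

lemma gauge_mult_eq:
  assumes v: "equivariant v" and t: "\<tau> \<in> twist_hom H C"
  shows "twist_mult H C (twist_mult H C (left_gauge v) \<tau>) (translate_gauge v) c =
    comult_sum C c (\<lambda>c1 c2. tensor_sum (\<tau> c2) (\<lambda>h d. comult_sum C d (\<lambda>d1 d2. (v c1 * h) \<otimes> (d1 \<cdot> v d2))))"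
proof -
  have "extend (translate_gauge v) s = tensor_sum s (\<lambda>h d. comult_sum C d (\<lambda>d1 d2. h \<otimes> (d1 \<cdot> v d2)))" for s
    by (simp add: extend_def lmult_def[symmetric]) (simp add: translate_gauge_def translate_def tens_sum lmult_sums)
  moreover have "twist_mult H C (twist_mult H C (left_gauge v) \<tau>) (translate_gauge v) c =
      comult_sum C c (\<lambda>c1 c2. lmult (v c1) (extend (translate_gauge v) (\<tau> c2)))"
    by (simp add: twist_mult_eq left_gauge_def extend_sums gauge_hom[OF v] t extend_lmult)
  ultimately show ?thesis by (simp add: lmult_sums t)
qed


section \<open>Right linearity of the extension of a twisting\<close>

abbreviation pure_tensor_HC :: "('k, 'h, 'c) tensor \<Rightarrow> 'c \<Rightarrow> ('k, ('k, 'h, 'c) tensor, 'c) tensor" (infixl "\<odot>" 74)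
  where "t \<odot> d \<equiv> t \<otimes>\<^bsub>pscale,scl C\<^esub> d"

text \<open>
  The object \<open>H \<otimes> C\<close> of the category of right \<open>H\<close>-modules and right \<open>C\<close>-comodules. Its action is
  \<open>rmult\<close> and its coaction is \<open>id \<otimes> \<Delta>\<close>, with values in \<open>(H \<otimes> C) \<otimes> C\<close>.
\<close>

definition cofree_coact :: "('k, 'h, 'c) tensor \<Rightarrow> ('k, ('k, 'h, 'c) tensor, 'c) tensor"
  where "cofree_coact t = tensor_sum t (\<lambda>h d. comult_sum C d (\<lambda>d1 d2. (h \<otimes> d1) \<odot> d2))"

definition cofree_module :: "('k, 'h, 'c, ('k, 'h, 'c) tensor) hmodule"
  where "cofree_module = \<lparr>mspace = HC, mscl = pscale, mact = rmult, coact = cofree_coact\<rparr>"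

abbreviation HCC :: "('k, ('k, 'h, 'c) tensor, 'c) tensor set"
  where "HCC \<equiv> tensor_space pscale (scl C) HC"

abbreviation HCC_sum :: "('k, ('k, 'h, 'c) tensor, 'c) tensor \<Rightarrow>
    (('k, 'h, 'c) tensor \<Rightarrow> 'c \<Rightarrow> 'v::ab_group_add) \<Rightarrow> 'v"
  where "HCC_sum \<equiv> sweedler pscale (scl C) HC"

lemmas subspace_HC = subspace_tensor_space[of "scl H" "scl C" UNIV]

lemma HCC_tens [simp]: "t \<in> HC \<Longrightarrow> t \<odot> d \<in> HCC"
  by (rule tens_in_tensor_space)

lemma HCC_sums:
  "(\<And>a b. g a b \<in> HCC) \<Longrightarrow> comult_sum H k g \<in> HCC"
  "(\<And>a b. g' a b \<in> HCC) \<Longrightarrow> comult_sum C c g' \<in> HCC"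
  "t \<in> HC \<Longrightarrow> (\<And>a b. g'' a b \<in> HCC) \<Longrightarrow> tensor_sum t g'' \<in> HCC"
  "x \<in> HCC \<Longrightarrow> (\<And>a b. a \<in> HC \<Longrightarrow> f a b \<in> HCC) \<Longrightarrow> HCC_sum x f \<in> HCC"
  by (intro sweedler_in[OF vs(3)] lin_intros; simp)+

lemma cofree_coact_in [simp]: "t \<in> HC \<Longrightarrow> cofree_coact t \<in> HCC"
  unfolding cofree_coact_def by (intro HCC_sums HCC_tens HC_tens; simp)

lemma lin_cofree_coact:
  "linear_on s pscale V g \<Longrightarrow> (\<And>x. x \<in> V \<Longrightarrow> g x \<in> HC) \<Longrightarrow> linear_on s pscale V (\<lambda>x. cofree_coact (g x))"
  unfolding cofree_coact_def by (intro lin_intros; simp)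

lemma HCC_sum_tens:
  "vector_space sW \<Longrightarrow> bilinear_on pscale (scl C) sW HC F \<Longrightarrow> t \<in> HC \<Longrightarrow> HCC_sum (t \<odot> d) F = F t d"
  by (rule sweedler_tens[OF vs(3,2) _ subspace_HC])

lemma HCC_sum_bind:
  assumes W: "vector_space sW" and F: "bilinear_on pscale (scl C) sW HC F"
  shows "(\<And>a b. g a b \<in> HCC) \<Longrightarrow> HCC_sum (comult_sum H k g) F = comult_sum H k (\<lambda>a b. HCC_sum (g a b) F)"
  "(\<And>a b. g' a b \<in> HCC) \<Longrightarrow> HCC_sum (comult_sum C c g') F = comult_sum C c (\<lambda>a b. HCC_sum (g' a b) F)"
  "t \<in> HC \<Longrightarrow> (\<And>a b. g'' a b \<in> HCC) \<Longrightarrow> HCC_sum (tensor_sum t g'') F = tensor_sum t (\<lambda>a b. HCC_sum (g'' a b) F)"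
  "x \<in> HCC \<Longrightarrow> (\<And>a b. a \<in> HC \<Longrightarrow> f a b \<in> HCC) \<Longrightarrow> HCC_sum (HCC_sum x f) F = HCC_sum x (\<lambda>a b. HCC_sum (f a b) F)"
  by (intro sweedler_sweedler[OF W vs(3,2) subspace_HC F] lin_intros; simp)+

lemma HCC_sum_cong: "x \<in> HCC \<Longrightarrow> (\<And>a b. a \<in> HC \<Longrightarrow> f a b = g a b) \<Longrightarrow> HCC_sum x f = HCC_sum x g"
  by (rule sweedler_cong_on[OF vs(3,2) subspace_HC])

text \<open>
  The axioms of a Hopf module speak of Sweedler sums over \<open>cofree_coact t\<close>. Evaluating them turns
  each axiom for \<open>H \<otimes> C\<close> into the corresponding axiom for \<open>C\<close>.
\<close>

lemma cofree_coact_sum: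
  assumes W: "vector_space sW" and F: "bilinear_on pscale (scl C) sW HC F" and t: "t \<in> HC"
  shows "HCC_sum (cofree_coact t) F = tensor_sum t (\<lambda>h d. comult_sum C d (\<lambda>d1 d2. F (h \<otimes> d1) d2))"
  unfolding cofree_coact_def
  by (simp add: HCC_sum_bind[OF W F] t HCC_sums HCC_sum_tens[OF W F])

lemma cofree_coact_tens:
  "cofree_coact (h \<otimes> c) = comult_sum C c (\<lambda>c1 c2. (h \<otimes> c1) \<odot> c2)"
  unfolding cofree_coact_def by (intro tensor_sum_tens[OF vs(3)] lin_intros)

lemma cofree_coact_rmult:
  assumes t: "t \<in> HC"
  shows "cofree_coact (rmult t k) =
    HCC_sum (cofree_coact t) (\<lambda>m0 m1. comult_sum H k (\<lambda>k1 k2. rmult m0 k1 \<odot> (m1 \<cdot> k2)))"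
proof (rule HC_ext[OF _ _ t])
  fix h c
  let ?F = "\<lambda>m0 m1. comult_sum H k (\<lambda>k1 k2. rmult m0 k1 \<odot> (m1 \<cdot> k2))"
  have F: "bilinear_on pscale (scl C) pscale HC ?F"
    by (intro lin_intros lin_rmult; simp)
  have "cofree_coact (rmult (h \<otimes> c) k) =
      comult_sum H k (\<lambda>k1 k2. comult_sum C (c \<cdot> k2) (\<lambda>d1 d2. ((h * k1) \<otimes> d1) \<odot> d2))"
    unfolding rmult_tens cofree_coact_tens[symmetric]
    by (rule apply_on_HC[OF lin_cofree_coact[OF linear_on_ident]]) auto
  also have "\<dots> = comult_sum H k (\<lambda>k1 k2. comult_sum C c (\<lambda>c1 c2. comult_sum H k2 (\<lambda>k21 k22.
      ((h * k1) \<otimes> (c1 \<cdot> k21)) \<odot> (c2 \<cdot> k22))))"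
    by (intro sweedler_cong_UNIV comult_sum_act[OF vs(3)] lin_intros)
  also have "\<dots> = comult_sum C c (\<lambda>c1 c2. comult_sum H k (\<lambda>k1 k2. comult_sum H k2 (\<lambda>k21 k22.
      ((h * k1) \<otimes> (c1 \<cdot> k21)) \<odot> (c2 \<cdot> k22))))"
    by (rule sweedler_swap)
  also have "\<dots> = comult_sum C c (\<lambda>c1 c2. comult_sum H k (\<lambda>k1 k2. comult_sum H k1 (\<lambda>k11 k12.
      ((h * k11) \<otimes> (c1 \<cdot> k12)) \<odot> (c2 \<cdot> k2))))"
    by (intro sweedler_cong_UNIV H.comult_sum_comult_sum[OF vs(3), symmetric] lin_intros)
  also have "\<dots> = comult_sum C c (\<lambda>c1 c2. ?F (h \<otimes> c1) c2)"
    unfolding rmult_tens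
    by (intro sweedler_cong_UNIV
        linear_on_apply_sweedler[OF linear_on_tens_left[OF vs(3,2) linear_on_ident], symmetric])
  also have "\<dots> = HCC_sum (cofree_coact (h \<otimes> c)) ?F"
    unfolding cofree_coact_tens by (simp add: HCC_sum_bind[OF vs(3) F] HCC_sum_tens[OF vs(3) F])
  finally show "cofree_coact (rmult (h \<otimes> c) k) = HCC_sum (cofree_coact (h \<otimes> c)) ?F" .
qed (intro lin_intros lin_cofree_coact lin_rmult; simp)+

lemma cofree_coact_coassoc:
  assumes t: "t \<in> HC"
  shows "HCC_sum (cofree_coact t) (\<lambda>m0 m1. HCC_sum (cofree_coact m0) (\<lambda>m00 m01.
         m00 \<otimes>\<^bsub>pscale,pscale\<^esub> (m01 \<otimes>\<^bsub>scl C,scl C\<^esub> m1))) =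
      HCC_sum (cofree_coact t) (\<lambda>m0 m1. comult_sum C m1 (\<lambda>m11 m12.
         m0 \<otimes>\<^bsub>pscale,pscale\<^esub> (m11 \<otimes>\<^bsub>scl C,scl C\<^esub> m12)))"
proof -
  have "HCC_sum (cofree_coact t) (\<lambda>m0 m1. HCC_sum (cofree_coact m0) (\<lambda>m00 m01.
         m00 \<otimes>\<^bsub>pscale,pscale\<^esub> (m01 \<otimes>\<^bsub>scl C,scl C\<^esub> m1))) =
      tensor_sum t (\<lambda>h d. comult_sum C d (\<lambda>d1 d2. HCC_sum (cofree_coact (h \<otimes> d1)) (\<lambda>m00 m01.
         m00 \<otimes>\<^bsub>pscale,pscale\<^esub> (m01 \<otimes>\<^bsub>scl C,scl C\<^esub> d2))))"
    by (intro cofree_coact_sum[OF vs(3) _ t] lin_intros lin_cofree_coact; simp)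
  also have "\<dots> = tensor_sum t (\<lambda>h d. comult_sum C d (\<lambda>d1 d2. comult_sum C d1 (\<lambda>d11 d12.
         (h \<otimes> d11) \<otimes>\<^bsub>pscale,pscale\<^esub> (d12 \<otimes>\<^bsub>scl C,scl C\<^esub> d2))))"
  proof (intro sweedler_cong_UNIV)
    fix h d1 d2
    have F: "bilinear_on pscale (scl C) pscale HC
        (\<lambda>m00 m01. m00 \<otimes>\<^bsub>pscale,pscale\<^esub> (m01 \<otimes>\<^bsub>scl C,scl C\<^esub> d2))"
      by (intro lin_intros)
    show "HCC_sum (cofree_coact (h \<otimes> d1)) (\<lambda>m00 m01.
         m00 \<otimes>\<^bsub>pscale,pscale\<^esub> (m01 \<otimes>\<^bsub>scl C,scl C\<^esub> d2)) = comult_sum C d1 (\<lambda>d11 d12.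
         (h \<otimes> d11) \<otimes>\<^bsub>pscale,pscale\<^esub> (d12 \<otimes>\<^bsub>scl C,scl C\<^esub> d2))"
      unfolding cofree_coact_tens by (simp add: HCC_sum_bind[OF vs(3) F] HCC_sum_tens[OF vs(3) F])
  qed
  also have "\<dots> = tensor_sum t (\<lambda>h d. comult_sum C d (\<lambda>d1 d2. comult_sum C d2 (\<lambda>d21 d22.
         (h \<otimes> d1) \<otimes>\<^bsub>pscale,pscale\<^esub> (d21 \<otimes>\<^bsub>scl C,scl C\<^esub> d22))))"
    by (intro sweedler_cong_UNIV comult_sum_comult_sum[OF vs(3)] lin_intros)
  also have "\<dots> = HCC_sum (cofree_coact t) (\<lambda>m0 m1. comult_sum C m1 (\<lambda>m11 m12.
         m0 \<otimes>\<^bsub>pscale,pscale\<^esub> (m11 \<otimes>\<^bsub>scl C,scl C\<^esub> m12)))"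
    by (intro cofree_coact_sum[OF vs(3) _ t, symmetric] lin_intros; simp)
  finally show ?thesis .
qed

lemma cofree_coact_counit:
  assumes t: "t \<in> HC"
  shows "HCC_sum (cofree_coact t) (\<lambda>m0 m1. pscale (counit C m1) m0) = t"
proof -
  have "HCC_sum (cofree_coact t) (\<lambda>m0 m1. pscale (counit C m1) m0) =
      tensor_sum t (\<lambda>h d. comult_sum C d (\<lambda>d1 d2. pscale (counit C d2) (h \<otimes> d1)))"
    by (intro cofree_coact_sum[OF vs(3) _ t] lin_intros)
  also have "\<dots> = tensor_sum t (\<lambda>h d. h \<otimes> d)"
    by (intro sweedler_cong_UNIV comult_sum_counit_right lin_intros)
  also have "\<dots> = t" by (rule sweedler_tens_ident[OF vs(1,2) sub(1) t])
  finally show ?thesis .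
qed

lemma hopf_module_cofree: "hopf_module H C cofree_module"
proof -
  interpret P: vector_space "pscale :: 'k \<Rightarrow> ('k, 'h, 'c) tensor \<Rightarrow> _" by (rule vs(3))
  have lin_r: "linear_on pscale pscale HC (\<lambda>t. rmult t k)" for k
    by (intro lin_rmult linear_on_ident)
  have lin_c: "linear_on pscale pscale HC cofree_coact"
    by (intro lin_cofree_coact linear_on_ident)
  show ?thesis
    by (rule hopf_module.intro)
      (simp_all add: cofree_module_def subspace_HC P.vector_space_axioms rmult_rmult rmult_one
        linear_on_imp_linear[OF vs(1,3)] lin_rmult(1)[OF linear_on_ident]
        linear_on_add[OF lin_r] linear_on_scale[OF lin_r] linear_on_add[OF lin_c] linear_on_scale[OF lin_c]
        cofree_coact_coassoc cofree_coact_counit cofree_coact_rmult)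
qed

text \<open>
  The map \<open>id \<otimes> \<epsilon> \<otimes> id\<close> from \<open>(H \<otimes> C) \<otimes> C\<close> to \<open>H \<otimes> C\<close>, as a bilinear function.
\<close>

definition contract :: "('k, 'h, 'c) tensor \<Rightarrow> 'c \<Rightarrow> ('k, 'h, 'c) tensor"
  where "contract t d = tensor_sum t (\<lambda>h e. pscale (counit C e) (h \<otimes> d))"

lemma lin_contract:
  "linear_on s (scl C) V f \<Longrightarrow> linear_on s pscale V (\<lambda>x. contract t (f x))"
  "linear_on s pscale V g \<Longrightarrow> (\<And>x. x \<in> V \<Longrightarrow> g x \<in> HC) \<Longrightarrow> linear_on s pscale V (\<lambda>x. contract (g x) d)"
  unfolding contract_def by (intro lin_intros; simp)+

lemma contract_rmult_tens:
  "contract (rmult (g \<otimes> e) h) d = pscale (counit C e) ((g * h) \<otimes> d)"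
proof -
  have ct: "contract (g \<otimes> e) d = pscale (counit C e) (g \<otimes> d)" for g e
    unfolding contract_def by (intro tensor_sum_tens[OF vs(3)] lin_intros)
  have "contract (rmult (g \<otimes> e) h) d =
      comult_sum H h (\<lambda>h1 h2. contract ((g * h1) \<otimes> (e \<cdot> h2)) d)"
    unfolding rmult_tens by (rule apply_on_HC[OF lin_contract(2)[OF linear_on_ident]]) auto
  also have "\<dots> = comult_sum H h (\<lambda>h1 h2. pscale (counit H h2) (pscale (counit C e) ((g * h1) \<otimes> d)))"
    by (simp add: ct counit_act pscale_def mult_ac)
  also have "\<dots> = pscale (counit C e) ((g * h) \<otimes> d)"
    by (intro H.comult_sum_counit_right lin_intros)
  finally show ?thesis .
qed

lemma pscale_sum: "pscale r (sweedler s1 s2 U t f) = sweedler s1 s2 U t (\<lambda>a b. pscale r (f a b))"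
  by (rule linear_on_apply_sweedler[OF linear_on_scale_right[OF vs(3) linear_on_ident]])

text \<open>
  Let \<open>\<rho>\<^sup>l\<close> be the twisted coaction of \<open>H \<otimes> C\<close>, so \<open>\<rho>\<^sup>l(g \<otimes> e) = (g \<otimes> e\<^sub>1)h \<otimes> d\<close> with
  \<open>l(e\<^sub>2) = h \<otimes> d\<close>. Contracting the middle factor with \<open>\<epsilon>\<close> gives \<open>gh \<otimes> d\<close> with \<open>l(e) = h \<otimes> d\<close>: the
  contraction of \<open>\<rho>\<^sup>l(t)\<close> is the extension of \<open>l\<close> at \<open>t\<close>. Contracting both sides of the Hopf module
  axiom \<open>\<rho>\<^sup>l(tk) = \<rho>\<^sup>l(t)k\<close> therefore gives the claim.
\<close>

lemma twisting_extend_rmult: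
  assumes l: "twisting H C l" and t: "t \<in> HC"
  shows "extend l (rmult t k) = rmult (extend l t) k"
proof -
  have lh: "l \<in> twist_hom H C" using l by (simp add: twisting_def)
  note lins = lin_intros lin_rmult lin_contract lin_twist_hom[OF lh]
  \<comment> \<open>the twisted coaction of \<open>H \<otimes> C\<close>\<close>
  define tw where "tw m = HCC_sum (cofree_coact m) (\<lambda>m0 m1. tensor_sum (l m1) (\<lambda>h d. rmult m0 h \<odot> d))" for m
  have tw_in: "tw m \<in> HCC" if "m \<in> HC" for m
    unfolding tw_def using that lh by (intro HCC_sums HCC_tens rmult_in cofree_coact_in; simp)
  have "hopf_module H (twist_coalg H C l) (twist_module H C l cofree_module)"
    using l hopf_module_cofree by (simp add: twisting_def)
  then have compat: "tw (rmult t k) = HCC_sum (tw t) (\<lambda>m0 m1. comult_sum H k (\<lambda>k1 k2. rmult m0 k1 \<odot> (m1 \<cdot> k2)))"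
    using hopf_module.coact_act[of H "twist_coalg H C l" "twist_module H C l cofree_module" t k] t
    by (simp add: twist_coalg_def twist_module_def cofree_module_def tw_def)
  \<comment> \<open>evaluation of a bilinear function on the twisted coaction\<close>
  have tw_sum: "HCC_sum (tw m) G = tensor_sum m (\<lambda>g e. comult_sum C e (\<lambda>e1 e2.
      tensor_sum (l e2) (\<lambda>h d. G (rmult (g \<otimes> e1) h) d)))"
    if G: "bilinear_on pscale (scl C) pscale HC G" and m: "m \<in> HC"
    for m and G :: "_ \<Rightarrow> _ \<Rightarrow> ('k, 'h, 'c) tensor"
  proof -
    have G1: "linear_on s (scl C) V f \<Longrightarrow> b \<in> HC \<Longrightarrow> linear_on s pscale V (\<lambda>x. G b (f x))"
      for b s f and V :: "'x::ab_group_add set"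
      using G by (simp add: bilinear_on_def linear_on_def)
    have G2: "linear_on s pscale V f \<Longrightarrow> (\<And>x. x \<in> V \<Longrightarrow> f x \<in> HC) \<Longrightarrow> linear_on s pscale V (\<lambda>x. G (f x) d)"
      for d s f and V :: "'x::ab_group_add set"
      using G by (simp add: bilinear_on_def linear_on_def)
    have "HCC_sum (tw m) G = HCC_sum (cofree_coact m) (\<lambda>m0 m1. HCC_sum (tensor_sum (l m1) (\<lambda>h d. rmult m0 h \<odot> d)) G)"
      unfolding tw_def using m lh by (intro HCC_sum_bind[OF vs(3) G] HCC_sums HCC_tens rmult_in; simp)
    also have "\<dots> = HCC_sum (cofree_coact m) (\<lambda>m0 m1. tensor_sum (l m1) (\<lambda>h d. G (rmult m0 h) d))"
      using m lh by (intro HCC_sum_cong) (simp_all add: HCC_sum_bind[OF vs(3) G] HCC_sum_tens[OF vs(3) G])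
    also have "\<dots> = tensor_sum m (\<lambda>g e. comult_sum C e (\<lambda>e1 e2.
        tensor_sum (l e2) (\<lambda>h d. G (rmult (g \<otimes> e1) h) d)))"
      using m lh by (intro cofree_coact_sum[OF vs(3)] lins G1 G2) auto
    finally show ?thesis .
  qed
  have contract_eta: "contract (rmult (g \<otimes> e) h) = (\<lambda>d. pscale (counit C e) ((g * h) \<otimes> d))" for g e h
    by (simp add: fun_eq_iff contract_rmult_tens)
  have "HCC_sum (tw m) contract = extend l m" if m: "m \<in> HC" for m
  proof -
    have "HCC_sum (tw m) contract = tensor_sum m (\<lambda>g e. comult_sum C e (\<lambda>e1 e2.
        pscale (counit C e1) (lmult g (l e2))))"
      using m by (subst tw_sum) ((intro lins; simp), simp, simp add: contract_eta lmult_def pscale_sum)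
    also have "\<dots> = extend l m"
      unfolding extend_def lmult_def[symmetric]
      by (intro sweedler_cong_UNIV comult_sum_counit_left lins lin_lmult twist_hom_in lh)
    finally show ?thesis .
  qed
  note tw_contract = this
  have C: "bilinear_on pscale (scl C) pscale HC contract" by (intro lins; simp)
  have "extend l (rmult t k) = HCC_sum (tw (rmult t k)) contract"
    using t by (simp add: tw_contract)
  also have "\<dots> = HCC_sum (tw t) (\<lambda>m0 m1. comult_sum H k (\<lambda>k1 k2. contract (rmult m0 k1) (m1 \<cdot> k2)))"
    unfolding compat using t
    by (simp add: HCC_sum_bind[OF vs(3) C] HCC_sums tw_in)
       (intro HCC_sum_cong tw_in, simp_all add: HCC_sum_bind[OF vs(3) C] HCC_sum_tens[OF vs(3) C])
  also have "\<dots> = tensor_sum t (\<lambda>g e. comult_sum C e (\<lambda>e1 e2. tensor_sum (l e2) (\<lambda>h d.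
      comult_sum H k (\<lambda>k1 k2. contract (rmult (rmult (g \<otimes> e1) h) k1) (d \<cdot> k2)))))"
    using t by (intro tw_sum lins; simp)
  also have "\<dots> = tensor_sum t (\<lambda>g e. comult_sum C e (\<lambda>e1 e2.
      pscale (counit C e1) (rmult (lmult g (l e2)) k)))"
    by (simp add: rmult_rmult contract_rmult_tens)
      (simp add: lmult_def rmult_sums lh rmult_tens pscale_sum mult.assoc)
  also have "\<dots> = tensor_sum t (\<lambda>g e. rmult (lmult g (l e)) k)"
    by (intro sweedler_cong_UNIV comult_sum_counit_left lins lin_lmult twist_hom_in lmult_in lh)
  also have "\<dots> = rmult (extend l t) k"
    unfolding extend_def lmult_def[symmetric] using t by (simp add: rmult_sums lh)
  finally show ?thesis .
qed

section \<open>Invertibility along an equivalence\<close>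

text \<open>
  The relation \<open>E * l = A * \<tau> * D\<close> is solved for \<open>l\<close>; the inverse of \<open>E\<close> is the element \<open>right_gauge u\<close>
  of the convolution inverse \<open>u\<close> of \<open>v\<close>.
\<close>

theorem twist_invertible_if_equiv:
  assumes "twisting H C l" "twist_equiv H C \<tau> l" "twist_invertible H C \<tau>"
  shows "twist_invertible H C l"
proof -
  have lh: "l \<in> twist_hom H C" using assms(1) by (simp add: twisting_def)
  have th: "\<tau> \<in> twist_hom H C" using assms(3) by (simp add: twist_invertible_def)
  obtain v where v: "Vector_Spaces.linear (scl C) (scl H) v" "conv_invertible H C v"
    "\<And>c h. v (c \<cdot> h) = comult_sum H h (\<lambda>h1 h2. antipode H h1 * v c * h2)"
    and eq: "\<And>c. comult_sum C c (\<lambda>c1 c2. rmult (l c1) (v c2)) =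
      comult_sum C c (\<lambda>c1 c2. tensor_sum (\<tau> c2) (\<lambda>h d. comult_sum C d (\<lambda>d1 d2.
        (v c1 * h) \<otimes> (d1 \<cdot> v d2))))"
    using assms(2) unfolding twist_equiv_def rmult_def[symmetric] by blast
  obtain u where u: "Vector_Spaces.linear (scl C) (scl H) u"
    and vu: "\<And>c. comult_sum C c (\<lambda>c1 c2. v c1 * u c2) = scl H (counit C c) 1"
    and uv: "\<And>c. comult_sum C c (\<lambda>c1 c2. u c1 * v c2) = scl H (counit C c) 1"
    using v(2) unfolding conv_invertible_def by blast
  have ev: "equivariant v" by (rule equivariant_if_conjugation[OF v(1,3)])
  have eu: "equivariant u"
    by (rule equivariant_conv_inverse[OF ev linear_imp_linear_on[OF u] vu uv])
  note hom = gauge_hom[OF ev] gauge_hom[OF eu]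
  have inv: "twist_invertible H C (left_gauge v)" "twist_invertible H C (translate_gauge v)"
    "twist_invertible H C (right_gauge u)"
    unfolding twist_invertible_def using hom
      left_gauge_mult[OF ev eu vu] left_gauge_mult[OF eu ev uv]
      translate_gauge_mult[OF ev eu uv] translate_gauge_mult[OF eu ev vu]
      right_gauge_mult[OF ev eu uv] right_gauge_mult[OF eu ev vu] by blast+
  let ?N = "twist_mult H C (twist_mult H C (left_gauge v) \<tau>) (translate_gauge v)"
  have "twist_mult H C (right_gauge v) l = ?N"
    by (simp add: fun_eq_iff right_gauge_sum[OF lh twisting_extend_rmult[OF assms(1)]] eq gauge_mult_eq[OF ev th])
  then have "twist_mult H C (right_gauge u) ?N = twist_mult H C (twist_mult H C (right_gauge u) (right_gauge v)) l"
    by (simp add: twist_mult_assoc hom lh)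
  also have "\<dots> = l"
    by (simp add: right_gauge_mult[OF eu ev vu] twist_mult_one lh)
  finally show ?thesis
    using twist_invertible_mult[OF inv(3) twist_invertible_mult[OF twist_invertible_mult[OF inv(1) assms(3)] inv(2)]]
    by simp
qed

end

theorem theorem3p4:
  fixes H :: "('k::field, 'h::ring_1) hopf"
    and C :: "('k, 'h, 'c::ab_group_add) modcoalg"
    and \<tau> l :: "'c \<Rightarrow> ('k, 'h, 'c) tensor"
  assumes "hopf_algebra H"
    and "bij (antipode H)"
    and "right_module_coalgebra H C"
    and "twisting H C \<tau>"
    and "twisting H C l"
    and "twist_equiv H C \<tau> l"
    and "twist_invertible H C \<tau>"
  shows "twist_invertible H C l"
proof -
  interpret hopf_module_coalgebra H C
    using assms(1,3) by (simp add: hopf_module_coalgebra_def)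
  show ?thesis by (rule twist_invertible_if_equiv[OF assms(5-7)])
qed

end
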